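(* Let $G$ be a graph and let $u,v$ be two of its vertices. Suppose there is perfect state transfer between $u$ and $v$ at time $t=\pi/g$, for some positive integer $g$, and that $0$ is not in the eigenvalue support of $u$. Then there is pretty good state transfer between $(u,0)$ and $(v,0)$ in $G\circ K_1$.
   Context: Graphs are finite, simple and undirected; $A(X)$ is the adjacency matrix of a graph $X$ and $e_a$ the standard basis vector indexed by vertex $a$. There is perfect state transfer between distinct vertices $u,v$ of $X$ at time $\tau$ if $|e_v^Te^{-\mathrm{i}\tau A(X)}e_u|=1$. The eigenvalue support of $u$ in $G$ is the set of eigenvalues $\lambda$ of $A(G)$ with $E_\lambda e_u\ne0$, where $E_\lambda$ is the orthogonal projector onto the $\lambda$-eigenspace of $A(G)$. $K_1$ is the one-vertex graph. The corona $G\circ H$ of graphs $G,H$ has vertex set $V(G)\times(\{0\}\cup V(H))$ (where $0\notin V(H)$), and $(v,w)$ is adjacent to $(v',w')$ iff one of the following holds: $w=w'=0$ and $v,v'$ are adjacent in $G$; or $v=v'$ and $w,w'\in V(H)$ are adjacent in $H$; or $v=v'$ and exactly one of $w,w'$ equals $0$. A graph $X$ has pretty good state transfer between vertices $a,b$ if for every $\epsilon>0$ there are a time $\tau$ and a complex number $\gamma$ with $|\gamma|=1$ such that $\|e^{-\mathrm{i}\tau A(X)}e_a-\gamma e_b\|<\epsilon$. *)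

theory Defs
  imports "HOL-Analysis.Analysis"
begin

section \<open>Graphs\<close>

text \<open>
  A finite simple graph is given by its adjacency relation; its vertex set is the universe of a
  type of class \<open>finite\<close>, so that its vertices can index vectors and matrices.
\<close>

definition simple_graph :: "('a::finite \<Rightarrow> 'a \<Rightarrow> bool) \<Rightarrow> bool" where
  "simple_graph G \<longleftrightarrow> symp G \<and> irreflp G"

definition K1 :: "unit \<Rightarrow> unit \<Rightarrow> bool" where
  "K1 = (\<lambda>_ _. False)"

text \<open>In the corona, \<^term>\<open>None\<close> is the extra element \<open>0\<close> adjoined to the vertices of \<open>H\<close>.\<close>

definition corona ::
  "('a \<Rightarrow> 'a \<Rightarrow> bool) \<Rightarrow> ('b \<Rightarrow> 'b \<Rightarrow> bool) \<Rightarrow> 'a \<times> 'b option \<Rightarrow> 'a \<times> 'b option \<Rightarrow> bool" where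
  "corona G H = (\<lambda>(v, w) (v', w').
     (w = None \<and> w' = None \<and> G v v') \<or>
     (v = v' \<and> (\<exists>x y. w = Some x \<and> w' = Some y \<and> H x y)) \<or>
     (v = v' \<and> (w = None) \<noteq> (w' = None)))"

lemma simple_graph_K1: "simple_graph K1"
  by (simp add: simple_graph_def K1_def symp_def irreflp_def)

lemma simple_graph_corona:
  assumes "simple_graph G" "simple_graph H"
  shows "simple_graph (corona G H)"
  using assms by (fastforce simp: simple_graph_def corona_def symp_def irreflp_def)

definition adjacency_matrix :: "('a::finite \<Rightarrow> 'a \<Rightarrow> bool) \<Rightarrow> complex^'a^'a" where
  "adjacency_matrix G = (\<chi> i j. if G i j then 1 else 0)"


section \<open>The matrix exponential\<close>

text \<open>
  The constants \<^term>\<open>exp\<close> and \<^term>\<open>(^)\<close> are not usable here: the library's multiplication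
  \<^term>\<open>(*)\<close> on vectors, hence on matrices, is componentwise.
\<close>

primrec matrix_power :: "complex^'n^'n \<Rightarrow> nat \<Rightarrow> complex^'n^'n" where
  "matrix_power M 0 = mat 1"
| "matrix_power M (Suc n) = M ** matrix_power M n"

definition matrix_exp :: "complex^'n^'n \<Rightarrow> complex^'n^'n" where
  "matrix_exp M = (\<Sum>n. (1 / fact n) *\<^sub>R matrix_power M n)"

lemma norm_matrix_power_entry_le:
  fixes M :: "complex^'n^'n"
  shows "norm (matrix_power M n $ i $ j) \<le> (\<Sum>k\<in>UNIV. \<Sum>l\<in>UNIV. norm (M $ k $ l)) ^ n"
proof (induction n arbitrary: i)
  case 0
  show ?case by (simp add: mat_def)
next
  case (Suc n)
  let ?B = "\<Sum>k\<in>UNIV. \<Sum>l\<in>UNIV. norm (M $ k $ l)"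
  have "norm (matrix_power M (Suc n) $ i $ j)
      \<le> (\<Sum>k\<in>UNIV. norm (M $ i $ k * matrix_power M n $ k $ j))"
    by (simp add: matrix_matrix_mult_def norm_sum)
  also have "\<dots> \<le> (\<Sum>k\<in>UNIV. norm (M $ i $ k) * ?B ^ n)"
    by (intro sum_mono) (simp add: norm_mult mult_left_mono Suc.IH)
  also have "\<dots> = (\<Sum>k\<in>UNIV. norm (M $ i $ k)) * ?B ^ n"
    by (simp add: sum_distrib_right)
  also have "\<dots> \<le> ?B * ?B ^ n"
    by (intro mult_right_mono member_le_sum[where f = "\<lambda>i. \<Sum>k\<in>UNIV. norm (M $ i $ k)"]
        zero_le_power sum_nonneg) auto
  finally show ?case by simp
qed

lemma summable_matrix_exp:
  fixes M :: "complex^'n^'n"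
  shows "summable (\<lambda>n. (1 / fact n) *\<^sub>R matrix_power M n)"
proof -
  let ?B = "\<Sum>k\<in>UNIV. \<Sum>l\<in>UNIV. norm (M $ k $ l)"
  let ?C = "real CARD('n) * real CARD('n)"
  have bound: "norm (A :: complex^'n^'n) \<le> ?C * b" if "\<And>i j. norm (A $ i $ j) \<le> b" for A b
  proof -
    have "norm (A $ i) \<le> real CARD('n) * b" for i
    proof -
      have "norm (A $ i) \<le> (\<Sum>j\<in>UNIV. norm (A $ i $ j))"
        by (simp add: norm_vec_def L2_set_le_sum)
      also have "\<dots> \<le> real CARD('n) * b"
        using sum_bounded_above[of UNIV "\<lambda>j. norm (A $ i $ j)" b] that by simp
      finally show ?thesis .
    qed
    then have "(\<Sum>i\<in>UNIV. norm (A $ i)) \<le> real CARD('n) * (real CARD('n) * b)"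
      using sum_bounded_above[of UNIV "\<lambda>i. norm (A $ i)" "real CARD('n) * b"] by simp
    moreover have "norm A \<le> (\<Sum>i\<in>UNIV. norm (A $ i))"
      unfolding norm_vec_def[of A] by (rule L2_set_le_sum) simp
    ultimately show ?thesis by (simp add: mult.assoc)
  qed
  have "summable (\<lambda>n. ?C * (?B ^ n /\<^sub>R fact n))"
    using summable_exp_generic[of ?B] by (rule summable_mult)
  then show ?thesis
  proof (rule summable_comparison_test'[where N = 0])
    fix n
    have "norm (((1 / fact n) *\<^sub>R matrix_power M n) $ i $ j) \<le> ?B ^ n /\<^sub>R fact n" for i j
      using norm_matrix_power_entry_le[of M n i j]
      by (simp add: divide_simps)
    then show "norm ((1 / fact n) *\<^sub>R matrix_power M n) \<le> ?C * (?B ^ n /\<^sub>R fact n)"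
      by (rule bound)
  qed
qed

text \<open>\<open>transition_matrix G \<tau>\<close> is \<open>exp (-i \<tau> A(G))\<close>.\<close>

definition transition_matrix :: "('a::finite \<Rightarrow> 'a \<Rightarrow> bool) \<Rightarrow> real \<Rightarrow> complex^'a^'a" where
  "transition_matrix G \<tau> =
     matrix_exp (map_matrix (\<lambda>z. - (\<i> * complex_of_real \<tau>) * z) (adjacency_matrix G))"


section \<open>State transfer\<close>

definition perfect_state_transfer ::
  "('a::finite \<Rightarrow> 'a \<Rightarrow> bool) \<Rightarrow> 'a \<Rightarrow> 'a \<Rightarrow> real \<Rightarrow> bool" where
  "perfect_state_transfer G u v \<tau> \<longleftrightarrow>
     u \<noteq> v \<and> norm (scalar_product (axis v 1) (transition_matrix G \<tau> *v axis u 1)) = 1"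

definition pretty_good_state_transfer ::
  "('a::finite \<Rightarrow> 'a \<Rightarrow> bool) \<Rightarrow> 'a \<Rightarrow> 'a \<Rightarrow> bool" where
  "pretty_good_state_transfer G a b \<longleftrightarrow>
     (\<forall>\<epsilon>>0. \<exists>\<tau> \<gamma>. norm \<gamma> = 1 \<and> norm (transition_matrix G \<tau> *v axis a 1 - \<gamma> *s axis b 1) < \<epsilon>)"


section \<open>Eigenvalue support\<close>

definition eigenspace :: "complex^'n^'n \<Rightarrow> complex \<Rightarrow> (complex^'n) set" where
  "eigenspace M \<mu> = {x. M *v x = \<mu> *s x}"

definition eigenvalue :: "complex^'n^'n \<Rightarrow> complex \<Rightarrow> bool" where
  "eigenvalue M \<mu> \<longleftrightarrow> (\<exists>x. x \<noteq> 0 \<and> M *v x = \<mu> *s x)"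

definition conj_transpose :: "complex^'n^'n \<Rightarrow> complex^'n^'n" where
  "conj_transpose M = transpose (map_matrix cnj M)"

definition is_orthogonal_projector :: "complex^'n^'n \<Rightarrow> (complex^'n) set \<Rightarrow> bool" where
  "is_orthogonal_projector P S \<longleftrightarrow>
     P ** P = P \<and> conj_transpose P = P \<and> range (\<lambda>x. P *v x) = S"

definition orthogonal_projector :: "(complex^'n) set \<Rightarrow> complex^'n^'n" where
  "orthogonal_projector S = (THE P. is_orthogonal_projector P S)"

definition eigenvalue_support :: "('a::finite \<Rightarrow> 'a \<Rightarrow> bool) \<Rightarrow> 'a \<Rightarrow> complex set" where
  "eigenvalue_support G u =
     {\<mu>. eigenvalue (adjacency_matrix G) \<mu> \<and>
         orthogonal_projector (eigenspace (adjacency_matrix G) \<mu>) *v axis u 1 \<noteq> 0}"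

lemma subspace_eigenspace: "vec.subspace (eigenspace M \<mu>)"
  by (simp add: vec.subspace_def eigenspace_def matrix_vector_right_distrib
      vector_add_ldistrib vector_scalar_commute vec.scale_left_commute)

lemma conj_transpose_mult: "conj_transpose (A ** B) = conj_transpose B ** conj_transpose A"
  by (simp add: conj_transpose_def transpose_def matrix_matrix_mult_def vec_eq_iff mult.commute)

lemma is_orthogonal_projector_unique:
  fixes S :: "(complex^'n) set"
  assumes "is_orthogonal_projector P S" "is_orthogonal_projector Q S"
  shows "P = Q"
proof -
  have absorb: "A ** B = B" if "is_orthogonal_projector A S" "is_orthogonal_projector B S"
    for A B :: "complex^'n^'n"
  proof -
    have "A *v (B *v x) = B *v x" for x
    proof -
      have "B *v x \<in> range (\<lambda>x. A *v x)"
        using that by (auto simp: is_orthogonal_projector_def)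
      then obtain y where "B *v x = A *v y" by auto
      then show ?thesis
        using that(1) by (simp add: is_orthogonal_projector_def matrix_vector_mul_assoc)
    qed
    then show ?thesis
      by (simp add: matrix_eq matrix_vector_mul_assoc)
  qed
  have "P = conj_transpose (Q ** P)"
    using absorb[OF assms(2,1)] assms(1) by (simp add: is_orthogonal_projector_def)
  also have "\<dots> = P ** Q"
    using assms by (simp add: conj_transpose_mult is_orthogonal_projector_def)
  also have "\<dots> = Q"
    using absorb[OF assms] .
  finally show ?thesis .
qed

lemma is_orthogonal_projector_exists:
  fixes S :: "(complex^'n) set"
  assumes S: "vec.subspace S"
  shows "\<exists>P. is_orthogonal_projector P S"
proof -
  define h :: "complex^'n \<Rightarrow> complex^'n \<Rightarrow> complex"
    where "h x y = (\<Sum>i\<in>UNIV. x $ i * cnj (y $ i))" for x y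
  have h_add: "h (x + y) z = h x z + h y z" and h_diff: "h (x - y) z = h x z - h y z"
    and h_scale: "h (c *s x) z = c * h x z" for x y z c
    by (simp_all add: h_def algebra_simps sum.distrib sum_subtractf sum_distrib_left)
  have h_cnj: "cnj (h x y) = h y x" for x y
    by (simp add: h_def mult.commute)
  have Re_h: "Re (h x y) = x \<bullet> y" for x y
    by (simp add: h_def inner_vec_def inner_complex_def)
  have zero: "x = 0" if "h x x = 0" for x
    using that Re_h[of x x] by simp
  have add_S: "x + y \<in> S" and scale_S: "c *s x \<in> S" if "x \<in> S" "y \<in> S" for x y c
    using S that by (simp_all add: vec.subspace_def)
  have diff_S: "x - y \<in> S" if "x \<in> S" "y \<in> S" for x y
    using S that by (rule vec.subspace_diff)
  have "subspace S"
  proof -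
    have "c *\<^sub>R x \<in> S" if "x \<in> S" for c x
    proof -
      have "c *\<^sub>R x = complex_of_real c *s x"
        by (simp add: vec_eq_iff complex_eq_iff)
      then show ?thesis using scale_S[OF that that] by simp
    qed
    then show ?thesis
      using S by (simp add: subspace_def vec.subspace_def)
  qed
  have "\<exists>y. y \<in> S \<and> (\<forall>w\<in>S. h (x - y) w = 0)" for x
  proof -
    obtain y z where y: "y \<in> span S" and z: "\<And>w. w \<in> span S \<Longrightarrow> orthogonal z w"
      and x: "x = y + z"
      using orthogonal_subspace_decomp_exists[of S x] by blast
    have "h z w = 0" if w: "w \<in> S" for w
    proof (rule complex_eqI)
      have Re0: "Re (h z w') = 0" if "w' \<in> S" for w'
        using z[of w'] that by (simp add: Re_h orthogonal_def span_base)
      from w show "Re (h z w) = Re 0" by (simp add: Re0)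
      have "h z (\<i> *s w) = - \<i> * h z w"
        by (simp add: h_def sum_distrib_left algebra_simps sum_negf)
      then show "Im (h z w) = Im 0"
        using Re0[OF scale_S[OF w w, of \<i>]] by simp
    qed
    moreover have "y \<in> S"
      using y \<open>subspace S\<close> by (metis span_eq_iff)
    ultimately show ?thesis using x by (metis add_diff_cancel_left')
  qed
  then obtain f where f_S: "f x \<in> S" and f: "w \<in> S \<Longrightarrow> h (x - f x) w = 0" for x w
    by metis
  have f_eq: "f x = y" if "y \<in> S" "\<And>w. w \<in> S \<Longrightarrow> h (x - y) w = 0" for x y
  proof -
    have d: "f x - y \<in> S" using diff_S f_S that by blast
    have "h (f x - y) (f x - y) = h (x - y) (f x - y) - h (x - f x) (f x - y)"
      by (simp add: h_diff)
    then have "f x - y = 0"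
      using f[OF d] that(2)[OF d] by (intro zero) simp
    then show ?thesis by simp
  qed
  have f_id: "f x = x" if "x \<in> S" for x
    using that by (intro f_eq) (simp_all add: h_def)
  have "f (x + y) = f x + f y" for x y
    using f[of _ x] f[of _ y] by (intro f_eq add_S f_S) (simp add: h_add h_diff algebra_simps)
  moreover have "f (c *s x) = c *s f x" for c x
    using f[of _ x] scale_S[OF f_S f_S] by (intro f_eq) (auto simp: h_scale h_diff)
  ultimately have "Vector_Spaces.linear (*s) (*s) f"
    by (simp add: Vector_Spaces.linear_iff vec.vector_space_axioms)
  then have P: "matrix f *v x = f x" for x
    by (rule matrix_works)
  have "h (f x) y = h x (f y)" for x y
  proof -
    have "h (f x) y = h (f x) (f y)"
    proof -
      have "h (y - f y) (f x) = 0" by (rule f[OF f_S])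
      then show ?thesis
        using h_cnj[of y "f x"] h_cnj[of "f y" "f x"] by (simp add: h_diff)
    qed
    also have "\<dots> = h x (f y)"
      using f[OF f_S, of x y] by (simp add: h_diff)
    finally show ?thesis .
  qed
  then have adj: "h (f (axis j 1)) (axis i 1) = h (axis j 1) (f (axis i 1))" for i j .
  have h_axis: "h x (axis i 1) = x $ i" "h (axis i 1) x = cnj (x $ i)" for x i
    unfolding h_def axis_def by (simp_all add: if_distrib if_distribR cong: if_cong)
  have "conj_transpose (matrix f) $ i $ j = matrix f $ i $ j" for i j
    using adj[of j i] by (simp add: h_axis conj_transpose_def transpose_def matrix_def)
  then have "conj_transpose (matrix f) = matrix f"
    by (simp add: vec_eq_iff)
  moreover have "matrix f ** matrix f = matrix f"
  proof -
    have "(matrix f ** matrix f) *v x = matrix f *v x" for x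
      by (simp only: matrix_vector_mul_assoc[symmetric] P f_id[OF f_S])
    then show ?thesis by (auto intro: matrix_eq[THEN iffD2])
  qed
  moreover have "range (\<lambda>x. matrix f *v x) = S"
  proof
    show "range (\<lambda>x. matrix f *v x) \<subseteq> S"
      by (auto simp only: P f_S)
    show "S \<subseteq> range (\<lambda>x. matrix f *v x)"
      by (rule subsetI, rule_tac x = x in range_eqI) (simp only: P f_id)
  qed
  ultimately show ?thesis
    unfolding is_orthogonal_projector_def by blast
qed

lemma is_orthogonal_projector_orthogonal_projector:
  assumes "vec.subspace S"
  shows "is_orthogonal_projector (orthogonal_projector S) S"
  unfolding orthogonal_projector_def
  using is_orthogonal_projector_exists[OF assms] is_orthogonal_projector_unique
  by (metis theI)

end

theory Submission
  imports Defs
    "HOL-Computational_Algebra.Fundamental_Theorem_Algebra"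
    "HOL-Computational_Algebra.Squarefree"
begin

text \<open>
  Write \<open>A\<close> for the adjacency matrix of \<open>G\<close> and expand \<open>axis u 1\<close> as a sum of eigenvectors \<open>x \<theta>\<close>
  of \<open>A\<close>, with \<open>\<theta>\<close> running over the eigenvalue support of \<open>u\<close>
  (\<open>hermitian_eigenvector_decomposition\<close>).

  Perfect state transfer at time \<open>\<pi> / g\<close> says that the sum of the vectors
  \<open>exp (- \<i> \<pi> \<theta> / g) x \<theta>\<close> is \<open>\<gamma> axis v 1\<close>. Comparing this with its complex conjugate shows that the
  differences of the eigenvalues in the support are integers
  (\<open>perfect_state_transfer_eigenvalue_differences\<close>). The sum of the support is rational
  (\<open>sum_eigenvalues_rational\<close>), so the eigenvalues themselves are rational, and hence integers as
  eigenvalues of an integer matrix (\<open>eigenvalues_integer\<close>).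

  Over an eigenvalue \<open>\<theta>\<close> of \<open>G\<close>, the corona with \<open>K1\<close> has the eigenvalues
  \<open>(\<theta> \<plusminus> sqrt (\<theta>\<^sup>2 + 4)) / 2\<close>. If \<open>t * sqrt (\<theta>\<^sup>2 + 4) / 2\<close> is close to a multiple of \<open>2 \<pi>\<close> for
  all \<open>\<theta>\<close> in the support, then on the vectors \<open>x \<theta>\<close>, extended by zero to the corona, the transition
  matrix acts approximately as multiplication by \<open>exp (- \<i> t \<theta> / 2)\<close>
  (\<open>transition_matrix_corona_K1_approx\<close>). For \<open>t = 2 \<pi> / g + 4 \<pi> m\<close> with an integer \<open>m\<close> this is
  \<open>exp (- \<i> \<pi> \<theta> / g)\<close>, so the image of \<open>(u, 0)\<close> is close to \<open>\<gamma>\<close> times \<open>(v, 0)\<close>.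

  It remains to choose \<open>m\<close> such that \<open>(m + 1 / (2 g)) sqrt (\<theta>\<^sup>2 + 4)\<close> is close to an integer for all
  \<open>\<theta>\<close>. As \<open>\<theta>\<close> is a nonzero integer, \<open>\<theta>\<^sup>2 + 4\<close> is not a square. The square roots of distinct
  squarefree integers are linearly independent over the rationals
  (\<open>squarefree_sqrt_independent\<close>), and Kronecker's theorem provides \<open>m\<close>
  (\<open>simultaneous_approximation_sqrt\<close>).
\<close>

section \<open>Polynomials in a matrix\<close>

lemma matrix_vector_mult_sum:
  fixes A :: "complex^'n^'m"
  shows "A *v (\<Sum>i\<in>I. f i) = (\<Sum>i\<in>I. A *v f i)"
  by (induction I rule: infinite_finite_induct) (simp_all add: matrix_vector_right_distrib)

lemma matrix_power_eigenvector:
  assumes "A *v x = \<mu> *s x"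
  shows "matrix_power A k *v x = \<mu> ^ k *s x"
proof (induction k)
  case (Suc k)
  have "matrix_power A (Suc k) *v x = A *v (\<mu> ^ k *s x)"
    by (simp add: matrix_vector_mul_assoc[symmetric] Suc.IH)
  then show ?case
    by (simp add: vector_scalar_commute assms vector_smult_assoc mult.commute)
qed simp

text \<open>
  The vector \<open>p(A) z\<close>, for a polynomial \<open>p\<close>, a square matrix \<open>A\<close> and a vector \<open>z\<close>.
\<close>

definition poly_act :: "complex poly \<Rightarrow> complex^'n^'n \<Rightarrow> complex^'n \<Rightarrow> complex^'n" where
  "poly_act p A z = (\<Sum>i\<le>degree p. coeff p i *s (matrix_power A i *v z))"

lemma poly_act_eq:
  assumes "degree p \<le> N"
  shows "poly_act p A z = (\<Sum>i\<le>N. coeff p i *s (matrix_power A i *v z))"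
  unfolding poly_act_def
  by (rule sum.mono_neutral_left) (use assms in \<open>auto simp: coeff_eq_0\<close>)

lemma poly_act_pCons: "poly_act (pCons a p) A z = a *s z + A *v poly_act p A z"
proof -
  have "poly_act (pCons a p) A z
      = (\<Sum>i\<le>Suc (degree p). coeff (pCons a p) i *s (matrix_power A i *v z))"
    by (rule poly_act_eq) (rule degree_pCons_le)
  also have "\<dots> = a *s z + (\<Sum>i\<le>degree p. coeff p i *s (matrix_power A (Suc i) *v z))"
    by (simp only: sum.atMost_Suc_shift) simp
  also have "(\<Sum>i\<le>degree p. coeff p i *s (matrix_power A (Suc i) *v z)) = A *v poly_act p A z"
    by (simp add: poly_act_def matrix_vector_mult_sum vector_scalar_commute
        matrix_vector_mul_assoc[symmetric])
  finally show ?thesis .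
qed

lemma poly_act_pCons_arg:
  "poly_act (pCons a p) A z = a *s z + poly_act p A (A *v z)"
proof (induction p arbitrary: a)
  case 0
  show ?case by (simp add: poly_act_pCons) (simp add: poly_act_def)
next
  case (pCons b p)
  show ?case
    by (subst poly_act_pCons, subst pCons.IH)
      (simp add: poly_act_pCons matrix_vector_right_distrib vector_scalar_commute)
qed

lemma poly_act_add: "poly_act (p + q) A z = poly_act p A z + poly_act q A z"
proof -
  define N where "N = max (degree p) (degree q)"
  have "degree (p + q) \<le> N" "degree p \<le> N" "degree q \<le> N"
    by (simp_all add: N_def degree_add_le_max)
  then show ?thesis
    by (simp add: poly_act_eq[where N = N] sum.distrib vector_sadd_rdistrib)
qed

lemma poly_act_smult: "poly_act (smult c p) A z = c *s poly_act p A z"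
  using degree_smult_le[of c p]
  by (simp add: poly_act_eq[where N = "degree p"] vec.scale_sum_right vector_smult_assoc)

lemma poly_act_linear_factor:
  "poly_act ([:-\<mu>, 1:] * p) A z = poly_act p A (A *v z - \<mu> *s z)"
proof -
  have diff: "poly_act p A (x - \<mu> *s y) = poly_act p A x - \<mu> *s poly_act p A y" for x y
    by (simp add: poly_act_def matrix_vector_mult_diff_distrib vec.scale_right_diff_distrib
        sum_subtractf vec.scale_sum_right vector_scalar_commute mult.commute)
  have "[:-\<mu>, 1:] * p = smult (-\<mu>) p + pCons 0 p"
    by simp
  then show ?thesis
    by (simp only: poly_act_add poly_act_smult poly_act_pCons_arg diff)
      (simp add: vec.scale_minus_left)
qed

text \<open>
  The vectors \<open>A\<^sup>i z\<close> with \<open>i \<le> n\<close> are \<open>n + 1\<close> vectors in an \<open>n\<close>-dimensional space. If two of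
  them coincide, a difference of two monomials annihilates \<open>z\<close>; otherwise a linear dependence
  among them gives the polynomial.
\<close>

lemma annihilating_poly_exists:
  fixes A :: "complex^'n^'n"
  shows "\<exists>p. p \<noteq> 0 \<and> poly_act p A z = 0"
proof (cases "inj_on (\<lambda>i. matrix_power A i *v z) {..CARD('n)}")
  case False
  then obtain i j where ij: "i \<noteq> j" "matrix_power A i *v z = matrix_power A j *v z"
    by (auto simp: inj_on_def)
  have mon: "poly_act (monom c k) A z = c *s (matrix_power A k *v z)" for c k
  proof -
    have "poly_act (monom c k) A z
        = (\<Sum>i\<le>k. (if i = k then c *s (matrix_power A k *v z) else 0))"
      unfolding poly_act_eq[OF degree_monom_le] by (rule sum.cong) auto
    then show ?thesis by simp
  qed
  have "poly_act (monom 1 i + monom (-1) j) A z = 0"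
    by (simp add: poly_act_add mon ij(2))
  moreover have "coeff (monom 1 i + monom (-1) j :: complex poly) i \<noteq> 0"
    using ij(1) by simp
  ultimately show ?thesis by (metis coeff_0)
next
  case True
  let ?v = "\<lambda>i. matrix_power A i *v z"
  let ?B = "?v ` {..CARD('n)}"
  have "card ?B = Suc CARD('n)"
    using card_image[OF True] by simp
  then have "vec.dependent ?B"
    using vec.independent_bound_general[of ?B] vec.dim_subset_UNIV[of ?B]
    by (auto simp: vec.dimension_def card_cart_basis)
  then obtain c b where b: "b \<in> ?B" "c b \<noteq> 0" and c: "(\<Sum>b\<in>?B. c b *s b) = 0"
    unfolding vec.dependent_finite[OF finite_imageI[OF finite_atMost]] by blast
  define p where "p = (\<Sum>i\<le>CARD('n). monom (c (?v i)) i)"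
  have co: "coeff p i = (if i \<le> CARD('n) then c (?v i) else 0)" for i
    by (simp add: p_def coeff_sum)
  have "degree p \<le> CARD('n)"
    by (rule degree_le) (simp add: co)
  then have "poly_act p A z = (\<Sum>i\<le>CARD('n). c (?v i) *s ?v i)"
    by (simp add: poly_act_eq co)
  also have "\<dots> = 0"
    using c by (subst (asm) sum.reindex[OF True]) simp
  finally have "poly_act p A z = 0" .
  moreover obtain i where "i \<le> CARD('n)" "b = ?v i"
    using b by auto
  then have "coeff p i \<noteq> 0"
    using b co by simp
  ultimately show ?thesis by (metis coeff_0)
qed

section \<open>Hermitian matrices\<close>

text \<open>
  The standard sesquilinear inner product on complex vectors, linear in the first argument.
\<close>

definition hdot :: "complex^'n \<Rightarrow> complex^'n \<Rightarrow> complex" where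
  "hdot x y = (\<Sum>i\<in>UNIV. x $ i * cnj (y $ i))"

lemma hdot_add_left: "hdot (x + y) z = hdot x z + hdot y z"
  and hdot_diff_left: "hdot (x - y) z = hdot x z - hdot y z"
  and hdot_scale_left: "hdot (c *s x) z = c * hdot x z"
  and hdot_scale_right: "hdot x (c *s z) = cnj c * hdot x z"
  and hdot_zero_left [simp]: "hdot 0 z = 0"
  by (simp_all add: hdot_def algebra_simps sum.distrib sum_subtractf sum_distrib_left)

lemma hdot_sum_left: "hdot (\<Sum>i\<in>I. f i) z = (\<Sum>i\<in>I. hdot (f i) z)"
  by (induction I rule: infinite_finite_induct) (simp_all add: hdot_add_left)

lemma hdot_cnj: "hdot y x = cnj (hdot x y)"
  by (simp add: hdot_def mult.commute)

lemma hdot_self: "hdot x x = complex_of_real ((norm x)\<^sup>2)"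
  by (simp add: hdot_def complex_norm_square[symmetric] norm_vec_def L2_set_def sum_nonneg
      flip: of_real_power)

lemma hdot_self_eq_0 [simp]: "hdot x x = 0 \<longleftrightarrow> x = 0"
  by (simp add: hdot_self)

lemma hdot_adjoint:
  assumes "conj_transpose A = A"
  shows "hdot (A *v x) y = hdot x (A *v y)"
proof -
  have A: "A $ i $ j = cnj (A $ j $ i)" for i j
    using arg_cong[OF assms, of "\<lambda>M. M $ i $ j"] by (simp add: conj_transpose_def transpose_def)
  have "hdot (A *v x) y = (\<Sum>i\<in>UNIV. \<Sum>j\<in>UNIV. A $ i $ j * x $ j * cnj (y $ i))"
    by (simp add: hdot_def matrix_vector_mult_def sum_distrib_right)
  also have "\<dots> = (\<Sum>j\<in>UNIV. \<Sum>i\<in>UNIV. A $ i $ j * x $ j * cnj (y $ i))"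
    by (rule sum.swap)
  also have "\<dots> = (\<Sum>j\<in>UNIV. \<Sum>i\<in>UNIV. x $ j * cnj (A $ j $ i * y $ i))"
    by (intro sum.cong refl, subst A) (simp add: mult_ac)
  also have "\<dots> = hdot x (A *v y)"
    by (simp add: hdot_def matrix_vector_mult_def sum_distrib_left)
  finally show ?thesis .
qed

lemma hermitian_eigenvalue_real:
  assumes A: "conj_transpose A = A" and x: "A *v x = \<mu> *s x" "x \<noteq> 0"
  shows "cnj \<mu> = \<mu>"
  using hdot_adjoint[OF A, of x x] x by (simp add: hdot_scale_left hdot_scale_right)

lemma hermitian_eigenvectors_orthogonal:
  assumes A: "conj_transpose A = A" and x: "A *v x = \<mu> *s x" and y: "A *v y = \<nu> *s y"
    and "\<mu> \<noteq> \<nu>"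
  shows "hdot x y = 0"
proof (cases "y = 0")
  case True
  then show ?thesis by (simp add: hdot_def)
next
  case False
  then show ?thesis
    using hdot_adjoint[OF A, of x y] hermitian_eigenvalue_real[OF A y] assms
    by (simp add: hdot_scale_left hdot_scale_right)
qed

text \<open>
  If \<open>(A - \<mu>)\<^sup>2 z = 0\<close> for a Hermitian matrix \<open>A\<close>, then already \<open>(A - \<mu>) z = 0\<close>.
\<close>

lemma hermitian_generalized_eigenvector:
  assumes A: "conj_transpose A = A" and w: "A *v z - \<mu> *s z = w" and ww: "A *v w = \<mu> *s w"
  shows "w = 0"
proof (rule ccontr)
  assume "w \<noteq> 0"
  then have "cnj \<mu> = \<mu>"
    using hermitian_eigenvalue_real[OF A ww] by simp
  then have "hdot w w = 0"
    using hdot_adjoint[OF A, of z w]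
    by (subst (1) w[symmetric]) (simp add: hdot_diff_left hdot_scale_left hdot_scale_right ww)
  with \<open>w \<noteq> 0\<close> show False by simp
qed

text \<open>
  Induction on the degree of the annihilating polynomial. For a root \<open>\<mu>\<close> the vector
  \<open>(A - \<mu>) z\<close> is annihilated by a polynomial of smaller degree, hence a sum of eigenvectors.
  The components for eigenvalues \<open>\<theta> \<noteq> \<mu>\<close> can be divided by \<open>\<theta> - \<mu>\<close> and subtracted from \<open>z\<close>;
  what remains is a generalized eigenvector for \<open>\<mu>\<close>, and therefore an eigenvector.
\<close>

lemma annihilated_imp_sum_eigenvectors:
  fixes A :: "complex^'n^'n"
  assumes A: "conj_transpose A = A" and "p \<noteq> 0" "poly_act p A z = 0"
  shows "\<exists>S x. finite S \<and> z = (\<Sum>\<theta>\<in>S. x \<theta>) \<and> (\<forall>\<theta>\<in>S. A *v x \<theta> = \<theta> *s x \<theta>)"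
  using assms(2,3)
proof (induction "degree p" arbitrary: p z)
  case 0
  then obtain c where "p = [:c:]" "c \<noteq> 0"
    by (metis degree_eq_zeroE pCons_eq_0_iff)
  with 0 have "z = 0"
    by (simp add: poly_act_def)
  then show ?case by (intro exI[of _ "{}"]) simp
next
  case (Suc n)
  have "\<not> constant (poly p)"
    using Suc.hyps(2) by (simp add: constant_degree)
  then obtain \<mu> where "poly p \<mu> = 0"
    using fundamental_theorem_of_algebra by blast
  then obtain q where p: "p = [:-\<mu>, 1:] * q"
    by (auto simp: poly_eq_0_iff_dvd)
  with Suc.prems have "q \<noteq> 0" by auto
  then have "degree p = Suc (degree q)"
    unfolding p by (subst degree_mult_eq) auto
  then have "n = degree q"
    using Suc.hyps(2) by simp
  from Suc.hyps(1)[OF this \<open>q \<noteq> 0\<close>, of "A *v z - \<mu> *s z"] Suc.prems(2)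
  obtain S w where S: "finite S" and w: "A *v z - \<mu> *s z = (\<Sum>\<theta>\<in>S. w \<theta>)"
    and ev: "\<And>\<theta>. \<theta> \<in> S \<Longrightarrow> A *v w \<theta> = \<theta> *s w \<theta>"
    unfolding p poly_act_linear_factor by blast
  define y where "y \<theta> = (1 / (\<theta> - \<mu>)) *s w \<theta>" for \<theta>
  define z' where "z' = z - (\<Sum>\<theta>\<in>S - {\<mu>}. y \<theta>)"
  have y_ev: "A *v y \<theta> = \<theta> *s y \<theta>" if "\<theta> \<in> S" for \<theta>
    using ev[OF that] by (simp add: y_def vector_scalar_commute mult.commute)
  have y_w: "A *v y \<theta> - \<mu> *s y \<theta> = w \<theta>" if "\<theta> \<in> S - {\<mu>}" for \<theta>
  proof -
    have "A *v y \<theta> - \<mu> *s y \<theta> = (\<theta> - \<mu>) *s y \<theta>"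
      using y_ev that by (simp add: vec.scale_left_diff_distrib)
    then show ?thesis using that by (simp add: y_def)
  qed
  have "A *v z' - \<mu> *s z' = (A *v z - \<mu> *s z) - (\<Sum>\<theta>\<in>S - {\<mu>}. A *v y \<theta> - \<mu> *s y \<theta>)"
    by (simp add: z'_def matrix_vector_mult_diff_distrib matrix_vector_mult_sum
        vec.scale_right_diff_distrib vec.scale_sum_right sum_subtractf)
  also have "\<dots> = (\<Sum>\<theta>\<in>S. w \<theta>) - (\<Sum>\<theta>\<in>S - {\<mu>}. w \<theta>)"
    using y_w by (simp add: w)
  also have "\<dots> = (\<Sum>\<theta>\<in>S \<inter> {\<mu>}. w \<theta>)"
    using S by (subst sum.Int_Diff[of S _ "{\<mu>}"]) auto
  finally have z': "A *v z' - \<mu> *s z' = (\<Sum>\<theta>\<in>S \<inter> {\<mu>}. w \<theta>)" .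
  have "(\<Sum>\<theta>\<in>S \<inter> {\<mu>}. w \<theta>) = 0"
  proof (rule hermitian_generalized_eigenvector[OF A z'])
    show "A *v (\<Sum>\<theta>\<in>S \<inter> {\<mu>}. w \<theta>) = \<mu> *s (\<Sum>\<theta>\<in>S \<inter> {\<mu>}. w \<theta>)"
      using ev by (cases "\<mu> \<in> S") auto
  qed
  then have z'_ev: "A *v z' = \<mu> *s z'"
    using z' by simp
  define x where "x = y(\<mu> := z')"
  have "z = z' + (\<Sum>\<theta>\<in>S - {\<mu>}. y \<theta>)"
    by (simp add: z'_def)
  also have "(\<Sum>\<theta>\<in>S - {\<mu>}. y \<theta>) = (\<Sum>\<theta>\<in>S - {\<mu>}. x \<theta>)"
    by (rule sum.cong) (simp_all add: x_def)
  also have "z' + \<dots> = (\<Sum>\<theta>\<in>insert \<mu> S. x \<theta>)"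
    using S by (simp add: sum.insert_remove x_def)
  finally have "z = (\<Sum>\<theta>\<in>insert \<mu> S. x \<theta>)" .
  moreover have "\<forall>\<theta>\<in>insert \<mu> S. A *v x \<theta> = \<theta> *s x \<theta>"
    using y_ev z'_ev by (simp add: x_def)
  ultimately show ?case using S by (metis finite_insert)
qed

text \<open>
  Every vector has an expansion into nonzero eigenvectors of a Hermitian matrix, with at most one
  term for each eigenvalue. The index set \<open>S\<close> is then the eigenvalue support of the vector.
\<close>

theorem hermitian_eigenvector_decomposition:
  fixes A :: "complex^'n^'n"
  assumes A: "conj_transpose A = A"
  obtains S x where "finite S" "z = (\<Sum>\<theta>\<in>S. x \<theta>)"
    "\<And>\<theta>. \<theta> \<in> S \<Longrightarrow> A *v x \<theta> = \<theta> *s x \<theta>" "\<And>\<theta>. \<theta> \<in> S \<Longrightarrow> x \<theta> \<noteq> 0"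
proof -
  obtain p where "p \<noteq> 0" "poly_act p A z = 0"
    using annihilating_poly_exists[of A z] by blast
  from annihilated_imp_sum_eigenvectors[OF A this]
  obtain S x where S: "finite S" and z: "z = (\<Sum>\<theta>\<in>S. x \<theta>)"
    and ev: "\<forall>\<theta>\<in>S. A *v x \<theta> = \<theta> *s x \<theta>"
    by blast
  show ?thesis
  proof (rule that)
    show "finite {\<theta>\<in>S. x \<theta> \<noteq> 0}"
      using S by simp
    show "z = (\<Sum>\<theta>\<in>{\<theta>\<in>S. x \<theta> \<noteq> 0}. x \<theta>)"
      unfolding z by (rule sum.mono_neutral_right[OF S]) auto
    show "A *v x \<theta> = \<theta> *s x \<theta>" if "\<theta> \<in> {\<theta>\<in>S. x \<theta> \<noteq> 0}" for \<theta>
      using ev that by blast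
    show "x \<theta> \<noteq> 0" if "\<theta> \<in> {\<theta>\<in>S. x \<theta> \<noteq> 0}" for \<theta>
      using that by blast
  qed
qed

lemma hermitian_eigenvector_component:
  fixes A :: "complex^'n^'n"
  assumes A: "conj_transpose A = A" and S: "finite S"
    and ev: "\<And>\<theta>. \<theta> \<in> S \<Longrightarrow> A *v x \<theta> = \<theta> *s x \<theta>" and \<mu>: "\<mu> \<in> S"
  shows "hdot (\<Sum>\<theta>\<in>S. x \<theta>) (x \<mu>) = hdot (x \<mu>) (x \<mu>)"
proof -
  have "hdot (\<Sum>\<theta>\<in>S. x \<theta>) (x \<mu>) = (\<Sum>\<theta>\<in>S. hdot (x \<theta>) (x \<mu>))"
    by (simp add: hdot_sum_left)
  also have "\<dots> = (\<Sum>\<theta>\<in>{\<mu>}. hdot (x \<theta>) (x \<mu>))"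
    using S \<mu> by (intro sum.mono_neutral_right)
      (auto intro: hermitian_eigenvectors_orthogonal[OF A ev ev])
  finally show ?thesis by simp
qed

lemma hermitian_sum_eigenvectors_eq_0:
  fixes A :: "complex^'n^'n"
  assumes A: "conj_transpose A = A" and S: "finite S"
    and ev: "\<And>\<theta>. \<theta> \<in> S \<Longrightarrow> A *v x \<theta> = \<theta> *s x \<theta>"
    and 0: "(\<Sum>\<theta>\<in>S. x \<theta>) = 0" and \<mu>: "\<mu> \<in> S"
  shows "x \<mu> = 0"
  using hermitian_eigenvector_component[OF A S ev \<mu>] by (simp add: 0)

lemma norm_sum_phases_hermitian:
  fixes A :: "complex^'n^'n"
  assumes A: "conj_transpose A = A" and S: "finite S"
    and ev: "\<And>\<theta>. \<theta> \<in> S \<Longrightarrow> A *v x \<theta> = \<theta> *s x \<theta>"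
    and c: "\<And>\<theta>. \<theta> \<in> S \<Longrightarrow> norm (c \<theta>) = 1"
  shows "norm (\<Sum>\<theta>\<in>S. c \<theta> *s x \<theta>) = norm (\<Sum>\<theta>\<in>S. x \<theta>)"
proof -
  have *: "hdot (\<Sum>\<theta>\<in>S. c \<theta> *s x \<theta>) (\<Sum>\<theta>\<in>S. c \<theta> *s x \<theta>) = (\<Sum>\<theta>\<in>S. hdot (x \<theta>) (x \<theta>))"
    if c: "\<And>\<theta>. \<theta> \<in> S \<Longrightarrow> norm (c \<theta>) = 1" for c
  proof -
    have "hdot (c \<theta> *s x \<theta>) (\<Sum>\<nu>\<in>S. c \<nu> *s x \<nu>) = hdot (x \<theta>) (x \<theta>)" if l: "\<theta> \<in> S" for \<theta>
    proof -
      have "hdot (\<Sum>\<nu>\<in>S. c \<nu> *s x \<nu>) (c \<theta> *s x \<theta>)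
          = (\<Sum>\<nu>\<in>S. c \<nu> * cnj (c \<theta>) * hdot (x \<nu>) (x \<theta>))"
        by (simp add: hdot_sum_left hdot_scale_left hdot_scale_right sum_distrib_left mult_ac)
      also have "\<dots> = (\<Sum>\<nu>\<in>{\<theta>}. c \<nu> * cnj (c \<theta>) * hdot (x \<nu>) (x \<theta>))"
        using S l by (intro sum.mono_neutral_right)
          (auto intro: hermitian_eigenvectors_orthogonal[OF A ev ev])
      also have "\<dots> = hdot (x \<theta>) (x \<theta>)"
        using c[OF l] by (simp add: complex_norm_square[symmetric])
      finally show ?thesis
        by (subst hdot_cnj) (simp add: hdot_self)
    qed
    then show ?thesis by (simp add: hdot_sum_left)
  qed
  have "hdot (\<Sum>\<theta>\<in>S. c \<theta> *s x \<theta>) (\<Sum>\<theta>\<in>S. c \<theta> *s x \<theta>) = hdot (\<Sum>\<theta>\<in>S. x \<theta>) (\<Sum>\<theta>\<in>S. x \<theta>)"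
    using *[of c] *[of "\<lambda>_. 1"] c by simp
  then show ?thesis
    unfolding hdot_self of_real_eq_iff by (simp add: power2_eq_iff_nonneg)
qed

section \<open>Integrality of the eigenvalues\<close>

text \<open>
  Extending \<open>1\<close> to a basis of the complex numbers over the rationals, the coordinate of \<open>1\<close> is a
  rational-linear map that fixes the rationals. It turns a complex solution of a linear system with
  rational coefficients into a rational solution.
\<close>

lemma rational_retraction:
  obtains \<phi> :: "complex \<Rightarrow> rat" where
    "\<And>x y. \<phi> (x + y) = \<phi> x + \<phi> y" "\<And>q x. \<phi> (of_rat q * x) = q * \<phi> x" "\<phi> 1 = 1"
proof -
  interpret Q: vector_space "\<lambda>(q::rat) (z::complex). of_rat q * z"
    by unfold_locales (simp_all add: algebra_simps of_rat_add of_rat_mult)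
  define B where "B = Q.extend_basis {1}"
  have ind: "Q.independent {1}"
    by (simp add: Q.dependent_single)
  have B: "Q.independent B" "Q.span B = UNIV" "1 \<in> B"
    using Q.independent_extend_basis[OF ind] Q.span_extend_basis[OF ind]
      Q.extend_basis_superset[OF ind] by (auto simp: B_def)
  show ?thesis
  proof (rule that[of "\<lambda>z. Q.representation B z 1"])
    show "Q.representation B (x + y) 1 = Q.representation B x 1 + Q.representation B y 1" for x y
      by (subst Q.representation_add) (simp_all add: B)
    show "Q.representation B (of_rat q * x) 1 = q * Q.representation B x 1" for q x
      by (subst Q.representation_scale) (simp_all add: B)
    show "Q.representation B 1 1 = 1"
      using B by (simp add: Q.representation_basis)
  qed
qed

lemma common_denominator:
  fixes y :: "'a \<Rightarrow> rat"
  assumes "finite I"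
  shows "\<exists>d::int. d \<noteq> 0 \<and> (\<forall>i\<in>I. of_int d * y i \<in> \<int>)"
  using assms
proof (induction I rule: finite_induct)
  case empty
  show ?case by (intro exI[of _ 1]) simp
next
  case (insert j I)
  then obtain d :: int where d: "d \<noteq> 0" "\<And>i. i \<in> I \<Longrightarrow> of_int d * y i \<in> \<int>" by auto
  obtain a b where "quotient_of (y j) = (a, b)" by force
  then have ab: "y j = of_int a / of_int b" "b > 0"
    by (simp_all add: quotient_of_denom_pos quotient_of_div)
  have "of_int (d * b) * y i \<in> \<int>" if "i \<in> insert j I" for i
  proof (cases "i = j")
    case True
    have "of_int (d * b) * y i = of_int (d * a)"
      using ab True by simp
    then show ?thesis by (metis Ints_of_int)
  next
    case False
    have "of_int (d * b) * y i = of_int b * (of_int d * y i)"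
      by simp
    then show ?thesis
      using d(2)[of i] that False by (metis Ints_mult Ints_of_int insertE)
  qed
  then show ?case
    using d ab by (intro exI[of _ "d * b"]) auto
qed

text \<open>
  The powers of a rational number have a common denominator only if it is an integer.
\<close>

lemma rat_bounded_denominator_powers_imp_int:
  fixes l :: rat and d :: int
  assumes d: "d \<noteq> 0" and int: "\<And>k. of_int d * l ^ k \<in> \<int>"
  shows "l \<in> \<int>"
proof -
  obtain a b where ab: "quotient_of l = (a, b)" by force
  then have b: "b > 0" "coprime a b" and l: "l = of_int a / of_int b"
    by (simp_all add: quotient_of_denom_pos quotient_of_coprime quotient_of_div)
  define k where "k = nat \<bar>d\<bar>"
  obtain m where "of_int d * l ^ k = of_int m"
    using int[of k] by (auto elim: Ints_cases)
  then have "of_int (d * a ^ k) = (of_int (m * b ^ k) :: rat)"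
    using b by (simp add: l power_divide field_simps)
  then have "b ^ k dvd d * a ^ k"
    by (simp only: of_int_eq_iff dvd_triv_right)
  moreover have "coprime (b ^ k) (a ^ k)"
    using b by (simp add: coprime_commute)
  ultimately have "b ^ k dvd d"
    by (simp add: coprime_dvd_mult_left_iff)
  then have "b ^ k \<le> \<bar>d\<bar>"
    using d by (metis abs_of_nonneg b(1) dvd_imp_le_int zero_le_power less_imp_le)
  have "b = 1"
  proof (rule ccontr)
    assume "b \<noteq> 1"
    then have "2 ^ k \<le> b ^ k"
      using b by (intro power_mono) auto
    moreover have "int k < 2 ^ k"
      by (metis less_exp of_nat_less_numeral_power_cancel_iff)
    ultimately show False
      using \<open>b ^ k \<le> \<bar>d\<bar>\<close> by (simp add: k_def)
  qed
  then show ?thesis by (simp add: l)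
qed

text \<open>
  Scaling an eigenvector to have an entry \<open>1\<close> and applying the retraction gives a rational
  eigenvector \<open>y\<close>. If \<open>d\<close> clears its denominators, then \<open>d A\<^sup>k y = d \<theta>\<^sup>k y\<close> is integral for all
  \<open>k\<close>, so the powers of \<open>\<theta>\<close> have a common denominator.
\<close>

lemma rational_eigenvalue_integer_matrix:
  fixes A :: "complex^'n^'n"
  assumes A: "\<And>i j. A $ i $ j \<in> \<int>" and ev: "A *v x = \<theta> *s x" and "x \<noteq> 0" and "\<theta> \<in> \<rat>"
  shows "\<theta> \<in> \<int>"
proof -
  obtain \<phi> :: "complex \<Rightarrow> rat" where add: "\<And>x y. \<phi> (x + y) = \<phi> x + \<phi> y"
    and scale: "\<And>q x. \<phi> (of_rat q * x) = q * \<phi> x" and one: "\<phi> 1 = 1"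
    using rational_retraction by blast
  have zero: "\<phi> 0 = 0" using add[of 0 0] by simp
  have sum: "\<phi> (\<Sum>i\<in>I. f i) = (\<Sum>i\<in>I. \<phi> (f i))" for f :: "'n \<Rightarrow> complex" and I
    by (induction I rule: infinite_finite_induct) (simp_all add: zero add)
  obtain l :: rat where l: "\<theta> = of_rat l"
    using \<open>\<theta> \<in> \<rat>\<close> by (auto elim: Rats_cases)
  have "\<exists>k::int. A $ i $ j = of_int k" for i j
    using A[of i j] by (rule Ints_cases) blast
  then obtain a :: "'n \<Rightarrow> 'n \<Rightarrow> int" where a: "\<And>i j. A $ i $ j = of_int (a i j)"
    by metis
  obtain i0 where i0: "x $ i0 \<noteq> 0"
    using \<open>x \<noteq> 0\<close> by (auto simp: vec_eq_iff)
  define y where "y j = \<phi> (x $ j / x $ i0)" for j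
  have y0: "y i0 = 1"
    using i0 one by (simp add: y_def)
  have y: "(\<Sum>j\<in>UNIV. of_int (a i j) * y j) = l * y i" for i
  proof -
    have "(\<Sum>j\<in>UNIV. A $ i $ j * x $ j) = \<theta> * x $ i"
      using arg_cong[OF ev, of "\<lambda>v. v $ i"] by (simp add: matrix_vector_mult_def)
    then have "(\<Sum>j\<in>UNIV. A $ i $ j * (x $ j / x $ i0)) = \<theta> * (x $ i / x $ i0)"
      by (simp add: sum_divide_distrib[symmetric])
    then have "(\<Sum>j\<in>UNIV. of_rat (of_int (a i j)) * (x $ j / x $ i0))
        = of_rat l * (x $ i / x $ i0)"
      by (simp only: a l of_rat_of_int_eq)
    from arg_cong[OF this, of \<phi>] show ?thesis
      by (simp only: sum scale y_def)
  qed
  obtain d :: int where d: "d \<noteq> 0" "\<And>i. of_int d * y i \<in> \<int>"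
    using common_denominator[of UNIV y] by auto
  have "of_int d * l ^ k * y i \<in> \<int>" for k i
  proof (induction k arbitrary: i)
    case (Suc k)
    have "of_int d * l ^ Suc k * y i = of_int d * l ^ k * (l * y i)"
      by (simp only: power_Suc mult_ac)
    also have "\<dots> = (\<Sum>j\<in>UNIV. of_int (a i j) * (of_int d * l ^ k * y j))"
      unfolding y[symmetric] sum_distrib_left by (intro sum.cong refl) (simp only: mult_ac)
    also have "\<dots> \<in> \<int>"
      by (intro Ints_sum Ints_mult[OF Ints_of_int] Suc.IH)
    finally show ?case .
  qed (simp add: d)
  from this[of _ i0] have "of_int d * l ^ k \<in> \<int>" for k
    by (simp add: y0)
  then have "l \<in> \<int>"
    by (rule rat_bounded_denominator_powers_imp_int[OF d(1), of l])
  then show ?thesis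
    by (auto simp: l elim: Ints_cases)
qed

lemma prod_linear_factors:
  fixes S :: "'a::idom set"
  assumes "finite S"
  shows "degree (\<Prod>a\<in>S. [:-a, 1:]) = card S" "coeff (\<Prod>a\<in>S. [:-a, 1:]) (card S) = 1"
    "S \<noteq> {} \<Longrightarrow> coeff (\<Prod>a\<in>S. [:-a, 1:]) (card S - 1) = - \<Sum>S"
proof -
  have deg: "degree (\<Prod>a\<in>S. [:-a, 1:]) = card S" if "finite S" for S :: "'a set"
    by (subst degree_prod_eq_sum_degree) auto
  have lead: "coeff (\<Prod>a\<in>S. [:-a, 1:]) (card S) = 1" if "finite S" for S :: "'a set"
    using lead_coeff_prod[of "\<lambda>a. [:-a, 1:]" S] deg[OF that] by simp
  show "degree (\<Prod>a\<in>S. [:-a, 1:]) = card S" "coeff (\<Prod>a\<in>S. [:-a, 1:]) (card S) = 1"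
    using deg[OF assms] lead[OF assms] by simp_all
  show "coeff (\<Prod>a\<in>S. [:-a, 1:]) (card S - 1) = - \<Sum>S" if "S \<noteq> {}"
    using assms that
  proof (induction S rule: finite_ne_induct)
    case (insert b S)
    let ?P = "\<Prod>a\<in>S. [:-a, 1:]"
    obtain n where n: "card S = Suc n"
      using insert.hyps by (metis card_eq_0_iff not0_implies_Suc)
    have "(\<Prod>a\<in>insert b S. [:-a, 1:]) = smult (-b) ?P + pCons 0 ?P"
      using insert.hyps by simp
    moreover have "coeff ?P (Suc n) = 1" "coeff ?P n = - \<Sum>S"
      using lead[OF insert.hyps(1)] insert.IH n by simp_all
    ultimately show ?case
      using insert.hyps n by (simp del: mult_pCons_left)
  qed simp
qed

text \<open>
  The polynomial \<open>q\<close> with the simple roots \<open>S\<close> annihilates \<open>z\<close>. Replacing its coefficients by their images under a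
  retraction onto the rationals gives a monic rational polynomial of the same degree that also
  annihilates \<open>z\<close>. That polynomial vanishes on \<open>S\<close>, so it equals \<open>q\<close>, whose coefficient in degree
  \<open>card S - 1\<close> is therefore rational.
\<close>

lemma sum_eigenvalues_rational:
  fixes A :: "complex^'n^'n"
  assumes A: "conj_transpose A = A" and rat: "\<And>i j. A $ i $ j \<in> \<rat>" "\<And>i. z $ i \<in> \<rat>"
    and S: "finite S" and z: "z = (\<Sum>\<theta>\<in>S. x \<theta>)"
    and ev: "\<And>\<theta>. \<theta> \<in> S \<Longrightarrow> A *v x \<theta> = \<theta> *s x \<theta>" and nz: "\<And>\<theta>. \<theta> \<in> S \<Longrightarrow> x \<theta> \<noteq> 0"
  shows "\<Sum>S \<in> \<rat>"
proof (cases "S = {}")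
  case False
  obtain \<phi> :: "complex \<Rightarrow> rat" where add: "\<And>x y. \<phi> (x + y) = \<phi> x + \<phi> y"
    and scale: "\<And>q x. \<phi> (of_rat q * x) = q * \<phi> x" and one: "\<phi> 1 = 1"
    using rational_retraction by blast
  have zero: "\<phi> 0 = 0" using add[of 0 0] by simp
  have sum: "\<phi> (\<Sum>i\<in>I. f i) = (\<Sum>i\<in>I. \<phi> (f i))" for f :: "nat \<Rightarrow> complex" and I
    by (induction I rule: infinite_finite_induct) (simp_all add: zero add)
  define n where "n = card S"
  define q where "q = (\<Prod>a\<in>S. [:-a, 1:])"
  have n: "n > 0"
    using S False by (simp add: n_def card_gt_0_iff)
  have q: "degree q = n" "coeff q n = 1" "coeff q (n - 1) = - \<Sum>S"
    using prod_linear_factors[OF S] False by (simp_all add: q_def n_def)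
  have q0: "poly q \<theta> = 0" if "\<theta> \<in> S" for \<theta>
    using S that by (simp add: q_def poly_prod prod_zero_iff)
  define r where "r = (\<Sum>i\<le>n. monom (of_rat (\<phi> (coeff q i)) :: complex) i)"
  have r: "coeff r i = (if i \<le> n then of_rat (\<phi> (coeff q i)) else 0)" for i
    by (simp add: r_def coeff_sum)
  have deg_r: "degree r \<le> n"
    by (rule degree_le) (simp add: r)
  have act: "(\<Sum>i\<le>n. coeff p i *s (matrix_power A i *v z)) = (\<Sum>\<theta>\<in>S. poly p \<theta> *s x \<theta>)"
    if "degree p \<le> n" for p
  proof -
    have poly_p: "poly p a = (\<Sum>i\<le>n. coeff p i * a ^ i)" for a
      unfolding poly_altdef
      by (rule sum.mono_neutral_left) (use that in \<open>auto simp: coeff_eq_0\<close>)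
    have "(\<Sum>i\<le>n. coeff p i *s (matrix_power A i *v z))
        = (\<Sum>i\<le>n. \<Sum>\<theta>\<in>S. (coeff p i * \<theta> ^ i) *s x \<theta>)"
      by (simp add: z matrix_vector_mult_sum matrix_power_eigenvector[OF ev]
          vec.scale_sum_right vector_smult_assoc)
    also have "\<dots> = (\<Sum>\<theta>\<in>S. \<Sum>i\<le>n. (coeff p i * \<theta> ^ i) *s x \<theta>)"
      by (rule sum.swap)
    also have "\<dots> = (\<Sum>\<theta>\<in>S. poly p \<theta> *s x \<theta>)"
      by (simp add: poly_p vec.scale_sum_left)
    finally show ?thesis .
  qed
  have pow_rat: "(matrix_power A i *v z) $ j \<in> \<rat>" for i j
  proof (induction i arbitrary: j)
    case (Suc i)
    have "(matrix_power A (Suc i) *v z) $ j = (\<Sum>k\<in>UNIV. A $ j $ k * (matrix_power A i *v z) $ k)"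
      by (simp only: matrix_power.simps matrix_vector_mul_assoc[symmetric])
        (simp only: matrix_vector_mult_def[of A] vec_lambda_beta)
    then show ?case
      using Suc.IH rat by (simp add: Rats_sum Rats_mult)
  qed (simp add: rat)
  have "(\<Sum>i\<le>n. coeff r i *s (matrix_power A i *v z)) = 0"
  proof (subst vec_eq_iff, rule allI)
    fix j
    have "\<exists>q. (matrix_power A i *v z) $ j = of_rat q" for i
      using pow_rat[of i j] by (rule Rats_cases) blast
    then obtain w :: "nat \<Rightarrow> rat" where w: "\<And>i. (matrix_power A i *v z) $ j = of_rat (w i)"
      by metis
    have "(\<Sum>i\<le>n. coeff q i *s (matrix_power A i *v z)) = 0"
      by (subst act) (simp_all add: q q0)
    from arg_cong[OF this, of "\<lambda>v. v $ j"]
    have "(\<Sum>i\<le>n. of_rat (w i) * coeff q i) = 0"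
      by (simp add: w mult.commute)
    from arg_cong[OF this, of \<phi>] have "(\<Sum>i\<le>n. w i * \<phi> (coeff q i)) = 0"
      by (simp only: sum scale zero)
    from arg_cong[OF this, of "of_rat :: rat \<Rightarrow> complex"]
    show "(\<Sum>i\<le>n. coeff r i *s (matrix_power A i *v z)) $ j = (0 :: complex^'n) $ j"
      by (simp add: r w of_rat_sum of_rat_mult mult.commute)
  qed
  then have "(\<Sum>\<theta>\<in>S. poly r \<theta> *s x \<theta>) = 0"
    by (subst (asm) act) (simp_all add: deg_r)
  from hermitian_sum_eigenvectors_eq_0[OF A S _ this]
  have "poly r \<theta> *s x \<theta> = 0" if "\<theta> \<in> S" for \<theta>
    using that by (simp add: vector_scalar_commute ev vector_smult_assoc mult.commute)
  then have r0: "poly r \<theta> = 0" if "\<theta> \<in> S" for \<theta>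
    using that nz by simp
  have "r - q = 0"
  proof (rule ccontr)
    assume ne: "r - q \<noteq> 0"
    have "coeff (r - q) n = 0"
      by (simp add: r q one)
    then have "degree (r - q) \<noteq> n"
      using ne by (metis leading_coeff_0_iff)
    moreover have "degree (r - q) \<le> n"
      using deg_r q by (intro degree_diff_le) auto
    ultimately have "degree (r - q) < n" by simp
    moreover have "S \<subseteq> {a. poly (r - q) a = 0}"
      using q0 r0 by auto
    then have "n \<le> degree (r - q)"
      unfolding n_def
      using card_mono[OF poly_roots_finite[OF ne]] card_poly_roots_bound[OF ne] le_trans by blast
    ultimately show False by simp
  qed
  then have "coeff r (n - 1) = - \<Sum>S"
    using q by simp
  then have "\<Sum>S = - of_rat (\<phi> (coeff q (n - 1)))"
    by (simp add: r equation_minus_iff)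
  then show ?thesis by simp
qed simp

text \<open>
  If the eigenvalues differ by rationals, each of them is their mean plus a rational; since their
  sum is rational, each of them is rational, and rational eigenvalues are integers.
\<close>

lemma eigenvalues_integer:
  fixes A :: "complex^'n^'n"
  assumes A: "conj_transpose A = A" and int: "\<And>i j. A $ i $ j \<in> \<int>" and z_rat: "\<And>i. z $ i \<in> \<rat>"
    and S: "finite S" and z: "z = (\<Sum>\<theta>\<in>S. x \<theta>)"
    and ev: "\<And>\<theta>. \<theta> \<in> S \<Longrightarrow> A *v x \<theta> = \<theta> *s x \<theta>" and nz: "\<And>\<theta>. \<theta> \<in> S \<Longrightarrow> x \<theta> \<noteq> 0"
    and diff: "\<And>\<theta> \<mu>. \<theta> \<in> S \<Longrightarrow> \<mu> \<in> S \<Longrightarrow> \<theta> - \<mu> \<in> \<rat>"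
    and \<mu>: "\<mu> \<in> S"
  shows "\<mu> \<in> \<int>"
proof (rule rational_eigenvalue_integer_matrix[OF int ev[OF \<mu>] nz[OF \<mu>]])
  have "(\<Sum>\<theta>\<in>S. \<theta>) \<in> \<rat>"
    using int by (intro sum_eigenvalues_rational[OF A _ z_rat S z ev nz])
      (auto intro: subsetD[OF Ints_subset_Rats])
  moreover have "(\<Sum>\<theta>\<in>S. \<theta> - \<mu>) \<in> \<rat>"
    using \<mu> diff by (intro Rats_sum) auto
  ultimately have "(\<Sum>\<theta>\<in>S. \<theta>) - (\<Sum>\<theta>\<in>S. \<theta> - \<mu>) \<in> \<rat>"
    by (rule Rats_diff)
  then have "of_nat (card S) * \<mu> / of_nat (card S) \<in> \<rat>"
    by (intro Rats_divide) (simp_all add: sum_subtractf)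
  then show "\<mu> \<in> \<rat>"
    using S \<mu> by (auto simp: card_eq_0_iff split: if_splits)
qed

section \<open>Square roots of integers\<close>

text \<open>
  \<open>surd_field K t\<close> says that \<open>K\<close> is a subfield of the reals and that \<open>t\<close> is a rational-linear
  functional on \<open>K\<close> that fixes \<open>1\<close> and vanishes at every square root of a nonsquare natural number
  that lies in \<open>K\<close>. It plays the part of the normalized trace of a multiquadratic field. The values
  of \<open>t\<close> outside \<open>K\<close> are irrelevant.
\<close>

definition surd_field :: "real set \<Rightarrow> (real \<Rightarrow> real) \<Rightarrow> bool" where
  "surd_field K t \<longleftrightarrow> \<rat> \<subseteq> K \<and>
     (\<forall>x\<in>K. \<forall>y\<in>K. x + y \<in> K \<and> x * y \<in> K \<and> t (x + y) = t x + t y) \<and>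
     (\<forall>x\<in>K. - x \<in> K \<and> inverse x \<in> K) \<and>
     (\<forall>q\<in>\<rat>. \<forall>x\<in>K. t (q * x) = q * t x) \<and> t 1 = 1 \<and>
     (\<forall>b::nat. sqrt (real b) \<in> K \<longrightarrow> (\<nexists>k. b = k\<^sup>2) \<longrightarrow> t (sqrt (real b)) = 0)"

lemma surd_field_Rats: "surd_field \<rat> (\<lambda>x. x)"
proof -
  have "\<exists>k. b = k\<^sup>2" if rat: "sqrt (real b) \<in> \<rat>" for b :: nat
  proof -
    obtain m n :: nat where mn: "n \<noteq> 0" "\<bar>sqrt (real b)\<bar> = m / n" "coprime m n"
      using Rats_abs_nat_div_natE[OF rat] by blast
    have "real b = (m / n)\<^sup>2"
      unfolding mn(2)[symmetric] by simp
    then have "real (b * n\<^sup>2) = real (m\<^sup>2)"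
      using mn(1) by (simp add: power_divide)
    then have eq: "b * n\<^sup>2 = m\<^sup>2"
      by (simp only: of_nat_eq_iff)
    then have "n\<^sup>2 dvd m\<^sup>2"
      by (metis dvd_triv_right)
    then have "n dvd m" by simp
    with mn(3) have "n = 1"
      by (metis coprime_common_divisor_nat dvd_refl nat_dvd_1_iff_1)
    with eq show ?thesis by auto
  qed
  then show ?thesis
    by (auto simp: surd_field_def Rats_add Rats_mult Rats_inverse)
qed

text \<open>
  In \<open>K(s)\<close> with \<open>s\<^sup>2 = a\<close> and \<open>s \<notin> K\<close>, the functional sends \<open>x + y s\<close> to \<open>t x\<close>. If the square of
  \<open>x + y s\<close> is a natural number, then \<open>x y = 0\<close>, for otherwise \<open>s\<close> could be solved for in \<open>K\<close>.
  Hence every square root in \<open>K(s)\<close> either lies in \<open>K\<close> or is a multiple of \<open>s\<close>.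
\<close>

lemma surd_field_adjoin:
  assumes K: "surd_field K t"
  obtains K' t' where "surd_field K' t'" "K \<subseteq> K'" "sqrt (real a) \<in> K'"
proof (cases "sqrt (real a) \<in> K")
  case True
  then show ?thesis using K that by blast
next
  case False
  define s where "s = sqrt (real a)"
  have s: "s \<notin> K" "s * s = real a"
    using False by (simp_all add: s_def)
  have Q: "q \<in> K" if "q \<in> \<rat>" for q
    using K that by (auto simp: surd_field_def)
  have add: "x + y \<in> K" and mul: "x * y \<in> K" and t_add: "t (x + y) = t x + t y"
    if "x \<in> K" "y \<in> K" for x y
    using K that by (auto simp: surd_field_def)
  have neg: "- x \<in> K" and inv: "inverse x \<in> K" if "x \<in> K" for x
    using K that by (auto simp: surd_field_def)
  have diff: "x - y \<in> K" and quot: "x / y \<in> K" if "x \<in> K" "y \<in> K" for x y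
    using add[OF that(1) neg[OF that(2)]] mul[OF that(1) inv[OF that(2)]]
    by (simp_all add: divide_inverse)
  have t_scale: "t (q * x) = q * t x" if "q \<in> \<rat>" "x \<in> K" for q x
    using K that by (auto simp: surd_field_def)
  have t1: "t 1 = 1"
    using K by (simp add: surd_field_def)
  have t_sqrt: "t (sqrt (real b)) = 0" if "sqrt (real b) \<in> K" "\<nexists>k. b = k\<^sup>2" for b :: nat
    using K that by (auto simp: surd_field_def)
  have K01: "0 \<in> K" "1 \<in> K" "real n \<in> K" for n
    using Q by simp_all
  have t0: "t 0 = 0"
    using t_scale[of 0 1] K01 by simp
  have uniq: "x = x' \<and> y = y'" if "x + y * s = x' + y' * s" and K: "x \<in> K" "y \<in> K" "x' \<in> K" "y' \<in> K"
    for x y x' y'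
  proof -
    have "y = y'"
    proof (rule ccontr)
      assume "y \<noteq> y'"
      then have "s = (x' - x) / (y - y')"
        using that(1) by (simp add: field_simps)
      then show False
        using s(1) quot[OF diff[OF K(3,1)] diff[OF K(2,4)]] by simp
    qed
    then show ?thesis using that(1) by simp
  qed
  define K' where "K' = {x + y * s | x y. x \<in> K \<and> y \<in> K}"
  define p where "p z = (SOME x. x \<in> K \<and> (\<exists>y\<in>K. z = x + y * s))" for z
  define t' where "t' z = t (p z)" for z
  have p: "p (x + y * s) = x" if "x \<in> K" "y \<in> K" for x y
    unfolding p_def
  proof (rule some_equality)
    show "x \<in> K \<and> (\<exists>y'\<in>K. x + y * s = x + y' * s)"
      using that by blast
    show "x' = x" if "x' \<in> K \<and> (\<exists>y'\<in>K. x + y * s = x' + y' * s)" for x'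
      using that uniq \<open>x \<in> K\<close> \<open>y \<in> K\<close> by blast
  qed
  have K'I: "x + y * s \<in> K'" if "x \<in> K" "y \<in> K" for x y
    using that by (auto simp: K'_def)
  have t'I: "t' (x + y * s) = t x" if "x \<in> K" "y \<in> K" for x y
    using that by (simp add: t'_def p)
  have K'E: "\<exists>x y. z = x + y * s \<and> x \<in> K \<and> y \<in> K" if "z \<in> K'" for z
    using that by (auto simp: K'_def)
  have K_sub: "K \<subseteq> K'"
    using K'I[OF _ K01(1)] by auto
  have t'_K: "t' x = t x" if "x \<in> K" for x
    using t'I[OF that K01(1)] by simp
  have "surd_field K' t'"
    unfolding surd_field_def
  proof (intro conjI ballI allI impI)
    show "\<rat> \<subseteq> K'"
      using Q K_sub by blast
    show "t' 1 = 1"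
      using t'_K K01 t1 by simp
  next
    fix z w assume "z \<in> K'" "w \<in> K'"
    then obtain x y x' y' where z: "z = x + y * s" "x \<in> K" "y \<in> K"
      and w: "w = x' + y' * s" "x' \<in> K" "y' \<in> K"
      using K'E by metis
    have sum: "z + w = (x + x') + (y + y') * s"
      by (simp add: z w algebra_simps)
    show "z + w \<in> K'"
      unfolding sum using z(2,3) w(2,3) by (intro K'I add)
    have "t' (z + w) = t (x + x')"
      unfolding sum using z(2,3) w(2,3) by (intro t'I add)
    also have "\<dots> = t' z + t' w"
      unfolding z(1) w(1) t'I[OF z(2,3)] t'I[OF w(2,3)] by (rule t_add[OF z(2) w(2)])
    finally show "t' (z + w) = t' z + t' w" .
    have "z * w = (x * x' + y * y' * (s * s)) + (x * y' + y * x') * s"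
      by (simp add: z w algebra_simps)
    then show "z * w \<in> K'"
      unfolding s(2) using z(2,3) w(2,3) by (auto intro: K'I add mul K01)
  next
    fix z assume "z \<in> K'"
    then obtain x y where z: "z = x + y * s" "x \<in> K" "y \<in> K"
      using K'E by metis
    have "- z = (- x) + (- y) * s"
      by (simp add: z)
    then show "- z \<in> K'"
      using K'I[OF neg neg] z by metis
    show "inverse z \<in> K'"
    proof (cases "z = 0")
      case True
      then show ?thesis using K_sub K01 by auto
    next
      case False
      define e where "e = x * x - y * y * real a"
      have "x - y * s \<noteq> 0"
      proof
        assume "x - y * s = 0"
        then have "x + (- y) * s = 0 + 0 * s" by simp
        from uniq[OF this z(2) neg[OF z(3)] K01(1) K01(1)] show False
          using False z by simp
      qed
      moreover have e: "e = z * (x - y * s)"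
        by (simp add: e_def z s(2)[symmetric] algebra_simps)
      ultimately have "inverse z = (x - y * s) / e"
        unfolding e using False by (simp add: divide_inverse)
      also have "\<dots> = (x / e) + (- y / e) * s"
        by (simp add: diff_divide_distrib)
      finally have "inverse z = (x / e) + (- y / e) * s" .
      moreover have "e \<in> K"
        unfolding e_def using z(2,3) K01(3) by (intro diff mul)
      ultimately show ?thesis
        using K'I[OF quot[OF z(2)] quot[OF neg[OF z(3)]]] by metis
    qed
  next
    fix q z :: real assume q: "q \<in> \<rat>" and "z \<in> K'"
    then obtain x y where z: "z = x + y * s" "x \<in> K" "y \<in> K"
      using K'E by metis
    have "q * z = q * x + (q * y) * s"
      by (simp add: z algebra_simps)
    then show "t' (q * z) = q * t' z"
      using z q Q by (simp add: t'I t_scale mul)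
  next
    fix b :: nat assume "sqrt (real b) \<in> K'" and ns: "\<nexists>k. b = k\<^sup>2"
    then obtain x y where xy: "sqrt (real b) = x + y * s" "x \<in> K" "y \<in> K"
      using K'E by metis
    have "real b = (x + y * s) * (x + y * s)"
      unfolding xy(1)[symmetric] by simp
    also have "\<dots> = x * x + y * y * (s * s) + 2 * x * y * s"
      by (simp add: algebra_simps)
    finally have b: "2 * x * y * s = real b - x * x - y * y * real a"
      by (simp add: s(2))
    have "x * y = 0"
    proof (rule ccontr)
      assume "x * y \<noteq> 0"
      then have "s = (real b - x * x - y * y * real a) / (2 * x * y)"
        using b by (simp add: field_simps)
      moreover have "2 \<in> K" using K01(3)[of 2] by simp
      ultimately show False
        using s(1) xy K01 by (metis quot diff mul)
    qed
    then show "t' (sqrt (real b)) = 0"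
    proof (cases "y = 0")
      case True
      then show ?thesis
        using xy t_sqrt[OF _ ns] t'_K by simp
    next
      case False
      with \<open>x * y = 0\<close> show ?thesis
        using xy t'I[OF xy(2,3)] t0 by simp
    qed
  qed
  moreover have "s \<in> K'"
    using K'I[OF K01(1,2)] by simp
  ultimately show ?thesis
    using K_sub that by (simp add: s_def)
qed

lemma surd_field_exists:
  assumes "finite C"
  shows "\<exists>K t. surd_field K t \<and> (\<forall>c\<in>C. sqrt (real c) \<in> K)"
  using assms
proof (induction C rule: finite_induct)
  case empty
  show ?case using surd_field_Rats by blast
next
  case (insert a C)
  then obtain K t where K: "surd_field K t" "\<forall>c\<in>C. sqrt (real c) \<in> K" by blast
  obtain K' t' where "surd_field K' t'" "K \<subseteq> K'" "sqrt (real a) \<in> K'"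
    using surd_field_adjoin[OF K(1)] by blast
  with K show ?case by blast
qed

lemma squarefree_mult_eq_square:
  fixes c d :: nat
  assumes "squarefree c" "squarefree d" "c * d = k\<^sup>2"
  shows "c = d"
proof -
  have nz: "c \<noteq> 0" "d \<noteq> 0"
    using assms by (metis not_squarefree_0)+
  with assms(3) have "k \<noteq> 0"
    by (metis mult_eq_0_iff zero_power2)
  show ?thesis
  proof (rule multiplicity_eq_nat)
    fix p :: nat assume p: "prime p"
    have "multiplicity p c \<le> 1" "multiplicity p d \<le> 1"
      using assms(1,2) p squarefree_factorial_semiring''[OF nz(1)]
        squarefree_factorial_semiring''[OF nz(2)] by auto
    moreover have "multiplicity p c + multiplicity p d = 2 * multiplicity p k"
      using p nz \<open>k \<noteq> 0\<close> arg_cong[OF assms(3), of "multiplicity p"]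
      by (simp add: prime_elem_multiplicity_mult_distrib prime_elem_multiplicity_power_distrib)
    ultimately show "multiplicity p c = multiplicity p d" by presburger
  qed (use nz in auto)
qed

text \<open>
  Multiplying a relation by the square root of \<open>c0\<close> and applying the functional \<open>t\<close> isolates the
  coefficient of \<open>c0\<close>, because \<open>c * c0\<close> is a nonsquare for every squarefree \<open>c \<noteq> c0\<close>.
\<close>

lemma squarefree_sqrt_independent:
  fixes C :: "nat set" and n :: "nat \<Rightarrow> int"
  assumes C: "finite C" and sf: "\<And>c. c \<in> C \<Longrightarrow> squarefree c"
    and 0: "(\<Sum>c\<in>C. of_int (n c) * sqrt (real c)) = 0" and c0: "c0 \<in> C"
  shows "n c0 = 0"
proof -
  obtain K t where K: "surd_field K t" and CK: "\<And>c. c \<in> C \<Longrightarrow> sqrt (real (c * c0)) \<in> K"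
    using surd_field_exists[of "(\<lambda>c. c * c0) ` C"] C by auto
  have t0: "t 0 = 0"
  proof -
    have "t (0 * 1) = 0 * t 1"
      using K Rats_0 Rats_1 unfolding surd_field_def by blast
    then show ?thesis by simp
  qed
  have t_scale: "t (q * x) = q * t x" "q * x \<in> K" if "q \<in> \<rat>" "x \<in> K" for q x
    using K that by (auto simp: surd_field_def)
  have t_sum: "(\<Sum>i\<in>I. f i) \<in> K \<and> t (\<Sum>i\<in>I. f i) = (\<Sum>i\<in>I. t (f i))"
    if "\<And>i. i \<in> I \<Longrightarrow> f i \<in> K" for f :: "nat \<Rightarrow> real" and I
    using that
  proof (induction I rule: infinite_finite_induct)
    case (insert i I)
    then have IH: "f i \<in> K" "(\<Sum>i\<in>I. f i) \<in> K" "t (\<Sum>i\<in>I. f i) = (\<Sum>i\<in>I. t (f i))" by auto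
    have "f i + (\<Sum>i\<in>I. f i) \<in> K \<and> t (f i + (\<Sum>i\<in>I. f i)) = t (f i) + t (\<Sum>i\<in>I. f i)"
      using K IH(1,2) unfolding surd_field_def by blast
    then show ?case using insert.hyps IH by simp
  qed (use K t0 in \<open>auto simp: surd_field_def\<close>)
  have "(\<Sum>c\<in>C. of_int (n c) * sqrt (real (c * c0))) = (\<Sum>c\<in>C. of_int (n c) * sqrt (real c)) * sqrt (real c0)"
    by (simp add: sum_distrib_right real_sqrt_mult mult.assoc)
  then have "t (\<Sum>c\<in>C. of_int (n c) * sqrt (real (c * c0))) = 0"
    by (simp only: 0 t0 mult_zero_left)
  moreover have "t (\<Sum>c\<in>C. of_int (n c) * sqrt (real (c * c0)))
      = (\<Sum>c\<in>C. t (of_int (n c) * sqrt (real (c * c0))))"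
    by (rule conjunct2[OF t_sum]) (rule t_scale(2)[OF Rats_of_int CK])
  ultimately have "0 = (\<Sum>c\<in>C. t (of_int (n c) * sqrt (real (c * c0))))"
    by simp
  also have "\<dots> = (\<Sum>c\<in>C. of_int (n c) * t (sqrt (real (c * c0))))"
    by (rule sum.cong[OF refl]) (rule t_scale(1)[OF Rats_of_int CK])
  also have "\<dots> = (\<Sum>c\<in>{c0}. of_int (n c) * t (sqrt (real (c * c0))))"
  proof (rule sum.mono_neutral_right[OF C])
    show "\<forall>c\<in>C - {c0}. of_int (n c) * t (sqrt (real (c * c0))) = 0"
    proof
      fix c assume c: "c \<in> C - {c0}"
      then have "\<nexists>k. c * c0 = k\<^sup>2"
        using squarefree_mult_eq_square sf c0 by blast
      moreover have "sqrt (real (c * c0)) \<in> K"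
        using CK c by blast
      ultimately have "t (sqrt (real (c * c0))) = 0"
        using K unfolding surd_field_def by blast
      then show "of_int (n c) * t (sqrt (real (c * c0))) = 0" by simp
    qed
  qed (use c0 in simp)
  finally have "of_int (n c0) * t (sqrt (real (c0 * c0))) = 0"
    by simp
  moreover have "t (sqrt (real (c0 * c0))) = real c0"
  proof -
    have "t (real c0 * 1) = real c0 * t 1" "t 1 = 1"
      using K Rats_1 Rats_of_nat[of c0] unfolding surd_field_def by blast+
    then show ?thesis by simp
  qed
  ultimately have "of_int (n c0) * real c0 = 0" by simp
  moreover have "c0 \<noteq> 0"
    using sf[OF c0] by (metis not_squarefree_0)
  ultimately show ?thesis by simp
qed

text \<open>
  Every \<open>sqrt b\<close> is an integer multiple of the square root of the squarefree part of \<open>b\<close>. Since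
  these square roots, together with \<open>1\<close>, are linearly independent over the integers, Kronecker's
  theorem applies to them, with the inhomogeneous targets \<open>- \<beta> * sqrt c\<close>.
\<close>

theorem simultaneous_approximation_sqrt:
  fixes N :: "nat set" and \<beta> \<epsilon> :: real
  assumes N: "finite N" and ns: "\<And>b k. b \<in> N \<Longrightarrow> b \<noteq> k\<^sup>2" and \<epsilon>: "\<epsilon> > 0"
  obtains m :: int where "\<And>b. b \<in> N \<Longrightarrow> \<exists>h::int. \<bar>(of_int m + \<beta>) * sqrt (real b) - of_int h\<bar> < \<epsilon>"
proof -
  define C where "C = squarefree_part ` N"
  have C: "finite C" "\<And>c. c \<in> C \<Longrightarrow> squarefree c"
    using N by (auto simp: C_def)
  have C1: "1 \<notin> C"
  proof
    assume "1 \<in> C"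
    then obtain b where "b \<in> N" "squarefree_part b = 1" by (auto simp: C_def)
    then show False
      using squarefree_decompose[of b] ns[of b "square_part b"] by simp
  qed
  define n where "n = card C"
  obtain f where f: "bij_betw f {0..<n} C"
    using ex_bij_betw_nat_finite[OF C(1)] by (auto simp: n_def)
  define F where "F i = (if i < n then f i else 1)" for i
  have F_img: "F ` {..n} = insert 1 C"
  proof -
    have "{..n} = insert n {0..<n}" by auto
    then show ?thesis
      using f by (auto simp: F_def bij_betw_def)
  qed
  have F_inj: "inj_on F {..n}"
  proof (rule eq_card_imp_inj_on)
    show "card (F ` {..n}) = card {..n}"
      unfolding F_img using C(1) C1 by (simp add: n_def)
  qed simp
  define \<theta> where "\<theta> i = sqrt (real (F i))" for i
  interpret Z: Modules.module "\<lambda>r x. real_of_int r * x"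
    by (simp add: Modules.module.intro distrib_left mult.commute)
  have indep: "module.independent (\<lambda>r x. real_of_int r * x) (\<theta> ` {..n})"
  proof
    assume "Z.dependent (\<theta> ` {..n})"
    then obtain T u v where T: "finite T" "T \<subseteq> \<theta> ` {..n}" "(\<Sum>v\<in>T. of_int (u v) * v) = 0"
      "v \<in> T" "u v \<noteq> 0"
      unfolding Z.dependent_explicit by blast
    define D where "D = {c \<in> insert 1 C. sqrt (real c) \<in> T}"
    have "T \<subseteq> (\<lambda>c. sqrt (real c)) ` insert 1 C"
      using T(2) unfolding \<theta>_def image_image[symmetric, of "\<lambda>c. sqrt (real c)" F] F_img .
    then have TD: "T = (\<lambda>c. sqrt (real c)) ` D"
      by (auto simp: D_def)
    obtain c0 where c0: "c0 \<in> D" "v = sqrt (real c0)"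
      using T(4) TD by auto
    have "inj_on (\<lambda>c. sqrt (real c)) D"
      by (auto simp: inj_on_def)
    then have "(\<Sum>c\<in>D. of_int (u (sqrt (real c))) * sqrt (real c)) = 0"
      using T(3) unfolding TD by (simp add: sum.reindex)
    then have "u (sqrt (real c0)) = 0"
      using C c0(1) by (intro squarefree_sqrt_independent[of D "\<lambda>c. u (sqrt (real c))"])
        (auto simp: D_def)
    with T(5) c0(2) show False by simp
  qed
  have inj: "inj_on \<theta> {..n}"
    using F_inj by (auto simp: \<theta>_def inj_on_def)
  have last: "\<theta> n = 1"
    by (simp add: \<theta>_def F_def)
  \<comment> \<open>The factor \<open>square_part b\<close> magnifies the error, which \<open>\<delta>\<close> compensates for.\<close>
  define \<delta> where "\<delta> = \<epsilon> / (1 + (\<Sum>b\<in>N. real (square_part b)))"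
  have pos: "1 + (\<Sum>b\<in>N. real (square_part b)) > 0"
    by (simp add: add_pos_nonneg sum_nonneg)
  then have \<delta>: "\<delta> > 0"
    using \<epsilon> by (simp add: \<delta>_def)
  obtain m h where mh: "\<And>i. i < n \<Longrightarrow> \<bar>of_int m * \<theta> i - of_int (h i) - (- \<beta> * \<theta> i)\<bar> < \<delta>"
    using Kronecker_thm_2[OF indep inj last \<delta>, of "\<lambda>i. - \<beta> * \<theta> i"] by blast
  show ?thesis
  proof (rule that)
    fix b assume b: "b \<in> N"
    define r where "r = square_part b"
    have "squarefree_part b \<in> f ` {0..<n}"
      using b f by (auto simp: C_def bij_betw_def)
    then obtain i where i: "i < n" "f i = squarefree_part b" by auto
    have "sqrt (real b) = sqrt (real (squarefree_part b * r\<^sup>2))"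
      unfolding r_def squarefree_decompose[symmetric] by simp
    also have "\<dots> = real r * \<theta> i"
      using i by (simp add: \<theta>_def F_def real_sqrt_mult)
    finally have sb: "sqrt (real b) = real r * \<theta> i" .
    have "r > 0"
      using ns[OF b, of 0] by (simp add: r_def) (metis gr0I square_part_0_iff)
    have "(of_int m + \<beta>) * sqrt (real b) - of_int (int r * h i)
        = real r * (of_int m * \<theta> i - of_int (h i) - (- \<beta> * \<theta> i))"
      unfolding sb by (simp add: algebra_simps)
    then have "\<bar>(of_int m + \<beta>) * sqrt (real b) - of_int (int r * h i)\<bar>
        = real r * \<bar>of_int m * \<theta> i - of_int (h i) - (- \<beta> * \<theta> i)\<bar>"
      by (simp only: abs_mult abs_of_nat)
    also have "\<dots> < real r * \<delta>"
      using mh[OF i(1)] \<open>r > 0\<close> by simp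
    also have "\<dots> \<le> \<epsilon>"
    proof -
      have "real r \<le> (\<Sum>b\<in>N. real (square_part b))"
        unfolding r_def using b N by (intro member_le_sum) auto
      then have "real r * \<epsilon> \<le> (1 + (\<Sum>b\<in>N. real (square_part b))) * \<epsilon>"
        using \<epsilon> by (intro mult_right_mono) auto
      then show ?thesis
        using pos by (simp add: \<delta>_def pos_divide_le_eq mult.commute)
    qed
    finally show "\<exists>h::int. \<bar>(of_int m + \<beta>) * sqrt (real b) - of_int h\<bar> < \<epsilon>" by blast
  qed
qed

section \<open>Transition matrices\<close>

lemma norm_vec_smult: "norm (c *s (x :: complex^'n)) = norm c * norm x"
  by (simp add: norm_vec_def norm_mult L2_set_right_distrib)

lemma matrix_exp_eigenvector:
  fixes M :: "complex^'n^'n"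
  assumes x: "M *v x = \<mu> *s x"
  shows "matrix_exp M *v x = exp \<mu> *s x"
proof -
  have lin1: "bounded_linear (\<lambda>M :: complex^'n^'n. M *v x)"
    unfolding linear_conv_bounded_linear[symmetric]
    by (rule linearI) (simp_all add: matrix_vector_mult_def vec_eq_iff scaleR_sum_right
        distrib_right sum.distrib)
  have lin2: "bounded_linear (\<lambda>c :: complex. c *s x)"
    unfolding linear_conv_bounded_linear[symmetric]
    by (rule linearI) (simp_all add: vec_eq_iff distrib_right)
  have "(\<lambda>n. (1 / fact n) *\<^sub>R matrix_power M n) sums matrix_exp M"
    unfolding matrix_exp_def using summable_matrix_exp by (rule summable_sums)
  from bounded_linear.sums[OF lin1 this]
  have "(\<lambda>n. ((1 / fact n) *\<^sub>R matrix_power M n) *v x) sums (matrix_exp M *v x)" .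
  moreover have "((1 / fact n) *\<^sub>R matrix_power M n) *v x = (\<mu> ^ n /\<^sub>R fact n) *s x" for n
  proof -
    have "((1 / fact n) *\<^sub>R matrix_power M n) *v x = (1 / fact n) *\<^sub>R (matrix_power M n *v x)"
      using bounded_linear.linear[OF lin1] by (rule linear_cmul)
    also have "\<dots> = (\<mu> ^ n /\<^sub>R fact n) *s x"
      by (simp add: matrix_power_eigenvector[OF x] vec_eq_iff divide_inverse)
    finally show ?thesis .
  qed
  moreover have "(\<lambda>n. (\<mu> ^ n /\<^sub>R fact n) *s x) sums (exp \<mu> *s x)"
    using bounded_linear.sums[OF lin2 exp_converges[of \<mu>]] .
  ultimately show ?thesis
    by (simp add: sums_unique2)
qed

lemma transition_matrix_eigenvector:
  assumes x: "adjacency_matrix G *v x = \<theta> *s x"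
  shows "transition_matrix G \<tau> *v x = exp (- (\<i> * complex_of_real \<tau>) * \<theta>) *s x"
  unfolding transition_matrix_def
proof (rule matrix_exp_eigenvector)
  have "map_matrix (\<lambda>z. c * z) A *v x = c *s (A *v x)" for c and A :: "complex^'a^'a"
    by (simp add: vec_eq_iff matrix_vector_mult_def map_matrix_def sum_distrib_left mult.assoc)
  then show "map_matrix ((*) (- (\<i> * complex_of_real \<tau>))) (adjacency_matrix G) *v x
      = (- (\<i> * complex_of_real \<tau>) * \<theta>) *s x"
    by (simp only: x vector_smult_assoc)
qed

lemma conj_transpose_adjacency_matrix:
  assumes "simple_graph G"
  shows "conj_transpose (adjacency_matrix G) = adjacency_matrix G"
  using assms by (auto simp: simple_graph_def symp_def vec_eq_iff conj_transpose_def
      transpose_def adjacency_matrix_def)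

lemma adjacency_matrix_Ints: "adjacency_matrix G $ i $ j \<in> \<int>"
  by (simp add: adjacency_matrix_def)

section \<open>Perfect state transfer\<close>

lemma eigenvalue_support_component:
  assumes G: "simple_graph G" and S: "finite S" and u: "axis u 1 = (\<Sum>\<theta>\<in>S. x \<theta>)"
    and ev: "\<And>\<theta>. \<theta> \<in> S \<Longrightarrow> adjacency_matrix G *v x \<theta> = \<theta> *s x \<theta>"
    and nz: "\<And>\<theta>. \<theta> \<in> S \<Longrightarrow> x \<theta> \<noteq> 0" and \<mu>: "\<mu> \<in> S"
  shows "\<mu> \<in> eigenvalue_support G u"
proof -
  define E where "E = eigenspace (adjacency_matrix G) \<mu>"
  define P where "P = orthogonal_projector E"
  have P: "P ** P = P" "conj_transpose P = P" "range (\<lambda>x. P *v x) = E"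
    using is_orthogonal_projector_orthogonal_projector[OF subspace_eigenspace]
    by (auto simp: P_def E_def is_orthogonal_projector_def)
  have "x \<mu> \<in> range (\<lambda>x. P *v x)"
    unfolding P(3) using ev[OF \<mu>] by (simp add: E_def eigenspace_def)
  then obtain y where y: "x \<mu> = P *v y" by auto
  have Px: "P *v x \<mu> = x \<mu>"
    unfolding y matrix_vector_mul_assoc P(1) by simp
  have "hdot (P *v axis u 1) (x \<mu>) = hdot (axis u 1) (x \<mu>)"
    by (simp add: hdot_adjoint[OF P(2)] Px)
  also have "\<dots> = hdot (x \<mu>) (x \<mu>)"
    unfolding u
    by (rule hermitian_eigenvector_component[OF conj_transpose_adjacency_matrix[OF G] S ev \<mu>])
  finally have "P *v axis u 1 \<noteq> 0"
    using nz[OF \<mu>] by auto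
  then show ?thesis
    using ev[OF \<mu>] nz[OF \<mu>] by (auto simp: eigenvalue_support_def eigenvalue_def P_def E_def)
qed

text \<open>
  The transition matrix preserves the norm of \<open>axis u 1\<close>, so an entry of modulus one in the image
  leaves no room for other entries.
\<close>

lemma perfect_state_transfer_phase:
  fixes G :: "'a::finite \<Rightarrow> 'a \<Rightarrow> bool"
  assumes G: "simple_graph G" and S: "finite S" and u: "axis u 1 = (\<Sum>\<theta>\<in>S. x \<theta>)"
    and ev: "\<And>\<theta>. \<theta> \<in> S \<Longrightarrow> adjacency_matrix G *v x \<theta> = \<theta> *s x \<theta>"
    and nz: "\<And>\<theta>. \<theta> \<in> S \<Longrightarrow> x \<theta> \<noteq> 0"
    and pst: "perfect_state_transfer G u v \<tau>"
  obtains \<gamma> where "norm \<gamma> = 1"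
    "(\<Sum>\<theta>\<in>S. exp (- (\<i> * complex_of_real \<tau>) * \<theta>) *s x \<theta>) = \<gamma> *s axis v 1"
proof -
  let ?A = "adjacency_matrix G"
  note A = conj_transpose_adjacency_matrix[OF G]
  define w where "w = transition_matrix G \<tau> *v axis u 1"
  have w: "w = (\<Sum>\<theta>\<in>S. exp (- (\<i> * complex_of_real \<tau>) * \<theta>) *s x \<theta>)"
    unfolding w_def u matrix_vector_mult_sum by (intro sum.cong refl transition_matrix_eigenvector ev)
  have "norm (exp (- (\<i> * complex_of_real \<tau>) * \<theta>)) = 1" if "\<theta> \<in> S" for \<theta>
  proof -
    have "cnj \<theta> = \<theta>"
      using hermitian_eigenvalue_real[OF A ev nz] that by blast
    then have "Im \<theta> = 0"
      by (simp add: complex_eq_iff)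
    then show ?thesis by simp
  qed
  then have "norm w = norm (axis u 1 :: complex^'a)"
    unfolding w u by (intro norm_sum_phases_hermitian[OF A S ev])
  then have "norm w = 1"
    by simp
  moreover have "norm (w $ v) = 1"
    using pst unfolding perfect_state_transfer_def w_def[symmetric]
    by (simp add: scalar_product_def axis_def if_distrib if_distribR cong: if_cong)
  ultimately have sq: "(\<Sum>i\<in>UNIV. (norm (w $ i))\<^sup>2) = (norm (w $ v))\<^sup>2"
    by (simp add: norm_vec_def L2_set_def real_sqrt_eq_1_iff)
  have "(\<Sum>i\<in>UNIV. (norm (w $ i))\<^sup>2) = (norm (w $ v))\<^sup>2 + (\<Sum>i\<in>UNIV - {v}. (norm (w $ i))\<^sup>2)"
    by (rule sum.remove) auto
  then have "(\<Sum>i\<in>UNIV - {v}. (norm (w $ i))\<^sup>2) = 0"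
    using sq by simp
  then have "\<forall>i\<in>UNIV - {v}. (norm (w $ i))\<^sup>2 = 0"
    by (subst (asm) sum_nonneg_eq_0_iff) auto
  then have "w = (w $ v) *s axis v 1"
    by (auto simp: vec_eq_iff axis_def)
  then show ?thesis
    using that[of "w $ v"] \<open>norm (w $ v) = 1\<close> unfolding w by simp
qed

text \<open>
  Both \<open>axis u 1\<close> and \<open>axis v 1\<close> are real vectors, so their components in the eigenspaces are
  real as well. The scalars \<open>d \<theta>\<close> relating these components are then real of modulus one, hence
  signs, and \<open>exp (- 2 \<i> \<pi> \<theta> / g)\<close> does not depend on \<open>\<theta>\<close>.
\<close>

lemma perfect_state_transfer_eigenvalue_differences:
  fixes G :: "'a::finite \<Rightarrow> 'a \<Rightarrow> bool" and g :: nat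
  assumes G: "simple_graph G" and S: "finite S" and u: "axis u 1 = (\<Sum>\<theta>\<in>S. x \<theta>)"
    and ev: "\<And>\<theta>. \<theta> \<in> S \<Longrightarrow> adjacency_matrix G *v x \<theta> = \<theta> *s x \<theta>"
    and nz: "\<And>\<theta>. \<theta> \<in> S \<Longrightarrow> x \<theta> \<noteq> 0" and "g > 0"
    and pst: "perfect_state_transfer G u v (pi / g)"
    and \<theta>: "\<theta> \<in> S" and \<mu>: "\<mu> \<in> S"
  shows "\<theta> - \<mu> \<in> \<int>"
proof -
  let ?A = "adjacency_matrix G"
  note A = conj_transpose_adjacency_matrix[OF G]
  define \<tau> where "\<tau> = pi / g"
  define e where "e \<theta> = exp (- (\<i> * complex_of_real \<tau>) * \<theta>)" for \<theta>
  obtain \<gamma> where \<gamma>: "norm \<gamma> = 1" "(\<Sum>\<theta>\<in>S. e \<theta> *s x \<theta>) = \<gamma> *s axis v 1"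
    using perfect_state_transfer_phase[OF G S u ev nz pst] unfolding e_def \<tau>_def by blast
  define conj_vec where "conj_vec y = (\<chi> i. cnj (y $ i))" for y :: "complex^'a"
  have conj_add: "conj_vec (y + z) = conj_vec y + conj_vec z"
    and conj_scale: "conj_vec (c *s y) = cnj c *s conj_vec y"
    and conj_axis: "conj_vec (axis i 1) = axis i 1" and conj_0: "conj_vec 0 = 0" for y z c i
    by (simp_all add: conj_vec_def vec_eq_iff axis_def)
  have conj_sum: "conj_vec (\<Sum>i\<in>I. f i) = (\<Sum>i\<in>I. conj_vec (f i))"
    for f :: "complex \<Rightarrow> complex^'a" and I
    by (induction I rule: infinite_finite_induct) (simp_all add: conj_add conj_0)
  have conj_A: "?A *v conj_vec y = conj_vec (?A *v y)" for y
    by (simp add: conj_vec_def vec_eq_iff matrix_vector_mult_def adjacency_matrix_def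
        if_distrib if_distribR cong: if_cong)
  have real: "cnj \<theta> = \<theta>" if "\<theta> \<in> S" for \<theta>
    using hermitian_eigenvalue_real[OF A ev nz] that by blast
  have conj_ev: "?A *v conj_vec (x \<theta>) = \<theta> *s conj_vec (x \<theta>)" if "\<theta> \<in> S" for \<theta>
    using that by (simp add: conj_A ev conj_scale real)
  have conj_x: "conj_vec (x \<theta>) = x \<theta>" if \<theta>: "\<theta> \<in> S" for \<theta>
  proof -
    have "(\<Sum>\<theta>\<in>S. conj_vec (x \<theta>) - x \<theta>) = 0"
      by (simp add: sum_subtractf conj_sum[symmetric] u[symmetric] conj_axis)
    from hermitian_sum_eigenvectors_eq_0[OF A S _ this \<theta>]
    show ?thesis
      by (simp add: matrix_vector_mult_diff_distrib vec.scale_right_diff_distrib ev conj_ev)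
  qed
  define d where "d \<theta> = cnj \<gamma> * e \<theta>" for \<theta>
  have v: "axis v 1 = (\<Sum>\<theta>\<in>S. d \<theta> *s x \<theta>)"
  proof -
    have "(\<Sum>\<theta>\<in>S. d \<theta> *s x \<theta>) = cnj \<gamma> *s (\<Sum>\<theta>\<in>S. e \<theta> *s x \<theta>)"
      by (simp add: d_def vec.scale_sum_right vector_smult_assoc)
    also have "\<dots> = (cnj \<gamma> * \<gamma>) *s axis v 1"
      by (simp only: \<gamma>(2) vector_smult_assoc)
    also have "cnj \<gamma> * \<gamma> = 1"
      using \<gamma>(1) by (metis complex_norm_square mult.commute of_real_1 one_power2)
    finally show ?thesis by simp
  qed
  have d_real: "cnj (d \<theta>) = d \<theta>" if \<theta>: "\<theta> \<in> S" for \<theta>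
  proof -
    have "conj_vec (\<Sum>\<theta>\<in>S. d \<theta> *s x \<theta>) = (\<Sum>\<theta>\<in>S. cnj (d \<theta>) *s x \<theta>)"
      by (simp add: conj_sum conj_scale conj_x)
    then have sum0: "(\<Sum>\<theta>\<in>S. (cnj (d \<theta>) - d \<theta>) *s x \<theta>) = 0"
      by (simp add: vec.scale_left_diff_distrib sum_subtractf v[symmetric] conj_axis)
    have "?A *v ((cnj (d \<theta>) - d \<theta>) *s x \<theta>) = \<theta> *s ((cnj (d \<theta>) - d \<theta>) *s x \<theta>)"
      if "\<theta> \<in> S" for \<theta>
      unfolding vector_scalar_commute ev[OF that] by (simp only: vector_smult_assoc mult.commute)
    then have "(cnj (d \<theta>) - d \<theta>) *s x \<theta> = 0"
      by (rule hermitian_sum_eigenvectors_eq_0[OF A S _ sum0 \<theta>])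
    then show ?thesis
      using nz[OF \<theta>] by simp
  qed
  have norm_e: "e \<theta> * cnj (e \<theta>) = 1" if "\<theta> \<in> S" for \<theta>
    using real[OF that] by (simp add: e_def exp_cnj exp_minus)
  have e_eq: "e \<theta> * e \<theta> = \<gamma> * \<gamma>" if "\<theta> \<in> S" for \<theta>
  proof -
    have "\<gamma> * cnj \<gamma> = 1"
      using \<gamma>(1) by (metis complex_norm_square of_real_1 one_power2)
    moreover have "\<gamma> * cnj (e \<theta>) = cnj \<gamma> * e \<theta>"
      using d_real[OF that] by (simp add: d_def)
    ultimately show ?thesis
      using norm_e[OF that] by algebra
  qed
  have "exp (2 * (- (\<i> * complex_of_real \<tau>) * \<theta>)) = exp (2 * (- (\<i> * complex_of_real \<tau>) * \<mu>))"
    using e_eq[OF \<theta>] e_eq[OF \<mu>] unfolding e_def exp_double by (simp add: power2_eq_square)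
  then obtain n :: int where
    "2 * (- (\<i> * complex_of_real \<tau>) * \<theta>)
      = 2 * (- (\<i> * complex_of_real \<tau>) * \<mu>) + of_int (2 * n) * pi * \<i>"
    unfolding exp_eq by blast
  then have "2 * \<i> * complex_of_real pi * (\<theta> - \<mu>) = 2 * \<i> * complex_of_real pi * (of_int (- n * int g))"
    using \<open>g > 0\<close> by (simp add: \<tau>_def field_simps)
  then have "\<theta> - \<mu> = of_int (- n * int g)"
    by (simp only: mult_cancel_left) simp
  then show ?thesis
    by (metis Ints_of_int)
qed

section \<open>The corona with a single vertex\<close>

text \<open>
  The vector on the corona with \<open>K1\<close> that is \<open>a\<close> on the vertices of the base graph and \<open>b\<close> on the
  pendant vertices attached to them.
\<close>

definition corona_vec :: "complex^'a \<Rightarrow> complex^'a \<Rightarrow> complex^('a \<times> unit option)" where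
  "corona_vec a b = (\<chi> p. case snd p of None \<Rightarrow> a $ fst p | Some _ \<Rightarrow> b $ fst p)"

lemma corona_vec_nth [simp]:
  "corona_vec a b $ (i, None) = a $ i" "corona_vec a b $ (i, Some j) = b $ i"
  by (simp_all add: corona_vec_def)

lemma vec_eq_corona_iff:
  fixes y z :: "complex^('a::finite \<times> unit option)"
  shows "y = z \<longleftrightarrow> (\<forall>i. y $ (i, None) = z $ (i, None) \<and> y $ (i, Some ()) = z $ (i, Some ()))"
  by (auto simp: vec_eq_iff split_option_all)

lemma corona_vec_add: "corona_vec a b + corona_vec c d = corona_vec (a + c) (b + d)"
  and corona_vec_diff: "corona_vec a b - corona_vec c d = corona_vec (a - c) (b - d)"
  and corona_vec_smult: "r *s corona_vec a b = corona_vec (r *s a) (r *s b)"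
  and corona_vec_axis: "corona_vec (axis i 1) 0 = axis (i, None) 1"
  by (auto simp: vec_eq_corona_iff axis_def)

lemma corona_vec_sum: "corona_vec (\<Sum>i\<in>I. f i) 0 = (\<Sum>i\<in>I. corona_vec (f i) 0)"
proof (induction I rule: infinite_finite_induct)
  case (insert i I)
  have "corona_vec (f i + (\<Sum>i\<in>I. f i)) 0 = corona_vec (f i) 0 + corona_vec (\<Sum>i\<in>I. f i) 0"
    by (simp add: corona_vec_add)
  then show ?case using insert by simp
qed (auto simp: vec_eq_corona_iff)

lemma sum_corona:
  fixes f :: "'a::finite \<times> unit option \<Rightarrow> complex"
  shows "(\<Sum>p\<in>UNIV. f p) = (\<Sum>i\<in>UNIV. f (i, None)) + (\<Sum>i\<in>UNIV. f (i, Some ()))"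
proof -
  have "(\<Sum>p\<in>UNIV. f p) = (\<Sum>i\<in>UNIV. \<Sum>w\<in>UNIV. f (i, w))"
    by (simp add: sum.cartesian_product UNIV_Times_UNIV[symmetric] del: UNIV_Times_UNIV)
  also have "\<dots> = (\<Sum>i\<in>UNIV. f (i, None) + f (i, Some ()))"
    by (simp add: UNIV_option_conv UNIV_unit)
  finally show ?thesis by (simp add: sum.distrib)
qed

lemma adjacency_matrix_corona_K1:
  "adjacency_matrix (corona G K1) *v corona_vec a b = corona_vec (adjacency_matrix G *v a + b) a"
proof (subst vec_eq_corona_iff, intro allI conjI)
  fix i
  have delta: "(\<Sum>j\<in>UNIV. (if i = j then 1 else 0) * c $ j) = (c $ i :: complex)" for c :: "complex^'a"
    by (simp add: if_distrib if_distribR cong: if_cong)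
  show "(adjacency_matrix (corona G K1) *v corona_vec a b) $ (i, None)
      = corona_vec (adjacency_matrix G *v a + b) a $ (i, None)"
    using delta[of b]
    by (simp add: matrix_vector_mult_def sum_corona adjacency_matrix_def corona_def)
  show "(adjacency_matrix (corona G K1) *v corona_vec a b) $ (i, Some ())
      = corona_vec (adjacency_matrix G *v a + b) a $ (i, Some ())"
    using delta[of a]
    by (simp add: matrix_vector_mult_def sum_corona adjacency_matrix_def corona_def K1_def)
qed

text \<open>
  An eigenvalue \<open>\<theta>\<close> of the base graph splits into the two roots of \<open>\<rho>\<^sup>2 = \<theta> \<rho> + 1\<close>.
\<close>

lemma corona_eigenvector:
  assumes x: "adjacency_matrix G *v x = \<theta> *s x" and \<rho>: "\<rho> * \<rho> = \<theta> * \<rho> + 1"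
  shows "adjacency_matrix (corona G K1) *v corona_vec (\<rho> *s x) x = \<rho> *s corona_vec (\<rho> *s x) x"
proof -
  have "adjacency_matrix G *v (\<rho> *s x) + x = (\<rho> * \<rho>) *s x"
    unfolding \<rho> vector_scalar_commute x
    by (simp add: vec.scale_left_distrib mult.commute)
  then show ?thesis
    by (simp add: adjacency_matrix_corona_K1 corona_vec_smult)
qed

lemma norm_exp_ii_minus_1_le: "norm (exp (\<i> * complex_of_real y) - 1) \<le> \<bar>y\<bar>"
proof -
  have "norm (exp (\<i> * complex_of_real y) - 1) = 2 * \<bar>sin (y / 2)\<bar>"
    by (rule dist_exp_i_1)
  also have "\<dots> \<le> 2 * \<bar>y / 2\<bar>"
    using abs_sin_x_le_abs_x[of "y / 2"] by simp
  finally show ?thesis by simp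
qed

text \<open>
  The two eigenvalues of the corona lying over \<open>l\<close> are \<open>(l \<plusminus> D) / 2\<close> with \<open>D = sqrt (l\<^sup>2 + 4)\<close>. If
  \<open>t * D / 2\<close> is close to a multiple of \<open>2 * pi\<close>, both act at time \<open>t\<close> by nearly the same phase
  \<open>exp (- \<i> t l / 2)\<close>. The constant \<open>B\<close> depends neither on \<open>t\<close> nor on the quality \<open>\<delta>\<close> of the
  approximation.
\<close>

lemma transition_matrix_corona_K1_approx:
  fixes G :: "'a::finite \<Rightarrow> 'a \<Rightarrow> bool"
  assumes x: "adjacency_matrix G *v x = complex_of_real l *s x"
  shows "\<exists>B\<ge>0. \<forall>t \<delta> (h::int). \<bar>t * sqrt (l\<^sup>2 + 4) / 2 - 2 * pi * of_int h\<bar> \<le> \<delta> \<longrightarrow>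
    norm (transition_matrix (corona G K1) t *v corona_vec x 0
      - exp (- (\<i> * complex_of_real (t * l / 2))) *s corona_vec x 0) \<le> \<delta> * B"
proof -
  define D where "D = sqrt (l\<^sup>2 + 4)"
  have DD: "D * D = l\<^sup>2 + 4"
    by (simp add: D_def add_nonneg_nonneg)
  have D: "D > 0"
    by (simp add: D_def add_nonneg_pos)
  \<comment> \<open>The sign \<open>s\<close>, which is \<open>1\<close> or \<open>- 1\<close>, selects one of the two eigenvalues.\<close>
  define r where "r s = complex_of_real ((l + s * D) / 2)" for s :: real
  have r: "r s * r s = complex_of_real l * r s + 1" if "s * s = 1" for s
  proof -
    have "((l + s * D) / 2) * ((l + s * D) / 2) = (l * l + 2 * l * (s * D) + (s * s) * (D * D)) / 4"
      by (simp add: algebra_simps)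
    also have "\<dots> = l * ((l + s * D) / 2) + 1"
      unfolding that DD by (simp add: field_simps power2_eq_square)
    finally have "complex_of_real (((l + s * D) / 2) * ((l + s * D) / 2))
        = complex_of_real (l * ((l + s * D) / 2) + 1)"
      by (rule arg_cong)
    then show ?thesis
      unfolding r_def by (simp only: of_real_mult of_real_add of_real_1)
  qed
  define y where "y s = corona_vec (r s *s x) x" for s
  have y: "transition_matrix (corona G K1) t *v y s = exp (- (\<i> * complex_of_real t) * r s) *s y s"
    if "s * s = 1" for s t
    unfolding y_def by (rule transition_matrix_eigenvector[OF corona_eigenvector[OF x r[OF that]]])
  define c where "c = complex_of_real (1 / D)"
  have x_y: "corona_vec x 0 = c *s (y 1 - y (-1))"
  proof -
    have "c * (r 1 - r (-1)) = 1"
    proof -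
      have "1 / D * ((l + 1 * D) / 2 - (l + (-1) * D) / 2) = 1"
        using D by (simp add: field_simps)
      then show ?thesis
        unfolding c_def r_def by (metis of_real_1 of_real_diff of_real_mult)
    qed
    then have "c *s (r 1 *s x - r (-1) *s x) = x"
      by (simp only: vec.scale_left_diff_distrib[symmetric] vector_smult_assoc) simp
    then show ?thesis
      by (simp add: y_def corona_vec_diff corona_vec_smult)
  qed
  define B where "B = (norm (y 1) + norm (y (-1))) / D"
  show ?thesis
  proof (intro exI[of _ B] conjI allI impI)
    show "B \<ge> 0"
      using D by (simp add: B_def)
  next
    fix t \<delta> :: real and h :: int
    assume close: "\<bar>t * sqrt (l\<^sup>2 + 4) / 2 - 2 * pi * of_int h\<bar> \<le> \<delta>"
    define e where "e = t * D / 2 - 2 * pi * of_int h"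
    define w where "w = exp (- (\<i> * complex_of_real (t * l / 2)))"
    have "norm w = 1"
      by (simp add: w_def)
    have phase: "exp (- (\<i> * complex_of_real t) * r s) = w * exp (\<i> * complex_of_real (- s * e))"
      if "s = 1 \<or> s = -1" for s
    proof -
      have "- (\<i> * complex_of_real t) * r s
          = (- (\<i> * complex_of_real (t * l / 2)) + \<i> * complex_of_real (- s * e))
            + of_int (2 * (if s = 1 then - h else h)) * pi * \<i>"
        using that by (auto simp: r_def e_def algebra_simps add_divide_distrib diff_divide_distrib)
      then show ?thesis
        unfolding w_def exp_add[symmetric] exp_eq by blast
    qed
    have small: "norm (exp (\<i> * complex_of_real (- s * e)) - 1) \<le> \<delta>" if "s = 1 \<or> s = -1" for s
    proof -
      have "norm (exp (\<i> * complex_of_real (- s * e)) - 1) \<le> \<bar>- s * e\<bar>"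
        by (rule norm_exp_ii_minus_1_le)
      also have "\<dots> \<le> \<delta>"
        using close that by (auto simp: e_def D_def)
      finally show ?thesis .
    qed
    define f where "f s = exp (\<i> * complex_of_real (- s * e)) - 1" for s
    have "transition_matrix (corona G K1) t *v corona_vec x 0
        = c *s ((w * (f 1 + 1)) *s y 1 - (w * (f (-1) + 1)) *s y (-1))"
      unfolding x_y vector_scalar_commute matrix_vector_mult_diff_distrib f_def
      using phase[of 1] phase[of "-1"] by (simp add: y)
    then have "transition_matrix (corona G K1) t *v corona_vec x 0 - w *s corona_vec x 0
        = (c * w) *s (f 1 *s y 1 - f (-1) *s y (-1))"
      unfolding x_y by (simp add: vec_eq_iff algebra_simps)
    moreover have "norm (c * w) = 1 / D"
      using D by (simp add: norm_mult \<open>norm w = 1\<close> c_def norm_divide)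
    ultimately have "norm (transition_matrix (corona G K1) t *v corona_vec x 0 - w *s corona_vec x 0)
        = norm (f 1 *s y 1 - f (-1) *s y (-1)) / D"
      by (simp only: norm_vec_smult) simp
    also have "\<dots> \<le> (\<delta> * norm (y 1) + \<delta> * norm (y (-1))) / D"
    proof (intro divide_right_mono)
      have "norm (f 1 *s y 1) \<le> \<delta> * norm (y 1)" "norm (f (-1) *s y (-1)) \<le> \<delta> * norm (y (-1))"
        unfolding norm_vec_smult f_def by (intro mult_right_mono small; simp)+
      then show "norm (f 1 *s y 1 - f (-1) *s y (-1)) \<le> \<delta> * norm (y 1) + \<delta> * norm (y (-1))"
        using norm_triangle_ineq4[of "f 1 *s y 1" "f (-1) *s y (-1)"] by linarith
    qed (use D in simp)
    also have "\<dots> = \<delta> * B"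
      by (simp add: B_def ring_distribs)
    finally show "norm (transition_matrix (corona G K1) t *v corona_vec x 0 - w *s corona_vec x 0)
        \<le> \<delta> * B" .
  qed
qed

lemma square_add_4_not_square:
  fixes a j :: nat
  assumes "a > 0"
  shows "a\<^sup>2 + 4 \<noteq> j\<^sup>2"
proof
  assume eq: "a\<^sup>2 + 4 = j\<^sup>2"
  then have "a\<^sup>2 < j\<^sup>2" by simp
  then have "a < j"
    by (simp add: power2_less_imp_less)
  then obtain d where j: "j = a + Suc d"
    by (metis less_iff_Suc_add add_Suc_right)
  show False
  proof (cases d)
    case 0
    then have "a * 2 = 3"
      using eq by (simp add: j power2_eq_square)
    then show False by presburger
  next
    case (Suc n)
    then have "a\<^sup>2 + 4 = (a + (2 + n))\<^sup>2"
      using eq by (simp add: j)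
    also have "\<dots> = a\<^sup>2 + 4 + 4 * a + n * (2 * a + 4 + n)"
      by (simp add: power2_eq_square algebra_simps)
    finally show False
      using assms by simp
  qed
qed

theorem theorem5p5:
  fixes G :: "'a::finite \<Rightarrow> 'a \<Rightarrow> bool" and u v :: 'a and g :: nat
  assumes "simple_graph G"
    and "g > 0"
    and "perfect_state_transfer G u v (pi / real g)"
    and "0 \<notin> eigenvalue_support G u"
  shows "pretty_good_state_transfer (corona G K1) (u, None) (v, None)"
proof -
  let ?A = "adjacency_matrix G"
  note G = assms(1)
  note A = conj_transpose_adjacency_matrix[OF G]
  obtain S x where S: "finite S" and u: "axis u 1 = (\<Sum>\<theta>\<in>S. x \<theta>)"
    and ev: "\<And>\<theta>. \<theta> \<in> S \<Longrightarrow> ?A *v x \<theta> = \<theta> *s x \<theta>" and nz: "\<And>\<theta>. \<theta> \<in> S \<Longrightarrow> x \<theta> \<noteq> 0"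
    by (rule hermitian_eigenvector_decomposition[OF A, of "axis u 1"]) blast
  have int: "\<theta> \<in> \<int>" if "\<theta> \<in> S" for \<theta>
  proof (rule eigenvalues_integer[OF A adjacency_matrix_Ints _ S u ev nz _ that])
    show "axis u 1 $ i \<in> \<rat>" for i :: 'a
      by (simp add: axis_def)
    show "\<theta> - \<mu> \<in> \<rat>" if "\<theta> \<in> S" "\<mu> \<in> S" for \<theta> \<mu>
      using perfect_state_transfer_eigenvalue_differences[OF G S u ev nz assms(2,3) that]
        Ints_subset_Rats by blast
  qed
  have "\<exists>k::int. \<theta> = of_int k" if "\<theta> \<in> S" for \<theta>
    using int[OF that] by (auto elim: Ints_cases)
  then obtain k :: "complex \<Rightarrow> int" where k: "\<And>\<theta>. \<theta> \<in> S \<Longrightarrow> \<theta> = of_int (k \<theta>)"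
    by metis
  have k0: "k \<theta> \<noteq> 0" if "\<theta> \<in> S" for \<theta>
    using eigenvalue_support_component[OF G S u ev nz that] assms(4) k[OF that] by auto
  define b where "b \<theta> = (nat \<bar>k \<theta>\<bar>)\<^sup>2 + 4" for \<theta>
  have b: "real (b \<theta>) = (real_of_int (k \<theta>))\<^sup>2 + 4" for \<theta>
    by (simp add: b_def)
  have "\<exists>B\<ge>0. \<forall>t \<delta> (h::int). \<bar>t * sqrt ((of_int (k \<theta>))\<^sup>2 + 4) / 2 - 2 * pi * of_int h\<bar> \<le> \<delta> \<longrightarrow>
      norm (transition_matrix (corona G K1) t *v corona_vec (x \<theta>) 0
        - exp (- (\<i> * complex_of_real (t * of_int (k \<theta>) / 2))) *s corona_vec (x \<theta>) 0) \<le> \<delta> * B"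
    if "\<theta> \<in> S" for \<theta>
    using ev[OF that] k[OF that] by (intro transition_matrix_corona_K1_approx) simp
  then obtain B where B0: "\<And>\<theta>. \<theta> \<in> S \<Longrightarrow> B \<theta> \<ge> 0"
    and B: "\<And>\<theta> t \<delta> (h::int). \<theta> \<in> S \<Longrightarrow>
      \<bar>t * sqrt ((of_int (k \<theta>))\<^sup>2 + 4) / 2 - 2 * pi * of_int h\<bar> \<le> \<delta> \<Longrightarrow>
      norm (transition_matrix (corona G K1) t *v corona_vec (x \<theta>) 0
        - exp (- (\<i> * complex_of_real (t * of_int (k \<theta>) / 2))) *s corona_vec (x \<theta>) 0) \<le> \<delta> * B \<theta>"
    by metis
  obtain \<gamma> where \<gamma>: "norm \<gamma> = 1"
    "(\<Sum>\<theta>\<in>S. exp (- (\<i> * complex_of_real (pi / g)) * \<theta>) *s x \<theta>) = \<gamma> *s axis v 1"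
    using perfect_state_transfer_phase[OF G S u ev nz assms(3)] by blast
  show ?thesis
    unfolding pretty_good_state_transfer_def
  proof (intro allI impI)
    fix \<epsilon> :: real assume \<epsilon>: "\<epsilon> > 0"
    define T where "T = 1 + (\<Sum>\<theta>\<in>S. B \<theta>)"
    have T: "T > 0"
      by (simp add: T_def add_pos_nonneg sum_nonneg B0)
    define \<delta> where "\<delta> = \<epsilon> / T"
    have \<delta>: "\<delta> > 0"
      using \<epsilon> T by (simp add: \<delta>_def)
    \<comment> \<open>With \<open>t / 2 = \<pi> / g + 2 \<pi> m\<close> the integrality of the eigenvalues makes the phases
      \<open>exp (- \<i> t \<theta> / 2)\<close> the same as those of the perfect state transfer, while \<open>m\<close> is still
      free for the approximation of the square roots.\<close>
    define \<beta> where "\<beta> = 1 / (2 * real g)"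
    have fin: "finite (b ` S)" and pos: "\<delta> / (2 * pi) > 0"
      using S \<delta> by simp_all
    have nonsquare: "n \<noteq> j\<^sup>2" if "n \<in> b ` S" for n j
      using that k0 square_add_4_not_square by (auto simp: b_def)
    obtain m :: int where m: "\<And>n. n \<in> b ` S \<Longrightarrow>
        \<exists>h::int. \<bar>(of_int m + \<beta>) * sqrt (real n) - of_int h\<bar> < \<delta> / (2 * pi)"
      using simultaneous_approximation_sqrt[where \<beta> = \<beta>, OF fin nonsquare pos] by blast
    define t where "t = 4 * pi * (of_int m + \<beta>)"
    have phase: "exp (- (\<i> * complex_of_real (t * of_int (k \<theta>) / 2)))
        = exp (- (\<i> * complex_of_real (pi / g)) * \<theta>)" if \<theta>: "\<theta> \<in> S" for \<theta>
    proof -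
      have "t * of_int (k \<theta>) / 2 = pi / g * of_int (k \<theta>) + of_int (2 * (m * k \<theta>)) * pi"
        using assms(2) by (simp add: t_def \<beta>_def field_simps)
      then have "- (\<i> * complex_of_real (t * of_int (k \<theta>) / 2))
          = - (\<i> * complex_of_real (pi / g)) * of_int (k \<theta>) + of_int (2 * (- (m * k \<theta>))) * pi * \<i>"
        by (simp only: of_real_add of_real_mult of_real_of_int_eq) (simp add: algebra_simps)
      then show ?thesis
        unfolding exp_eq using k[OF \<theta>] by metis
    qed
    have err: "norm (transition_matrix (corona G K1) t *v corona_vec (x \<theta>) 0
        - exp (- (\<i> * complex_of_real (pi / g)) * \<theta>) *s corona_vec (x \<theta>) 0) \<le> \<delta> * B \<theta>"
      if \<theta>: "\<theta> \<in> S" for \<theta>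
    proof -
      obtain h :: int where h: "\<bar>(of_int m + \<beta>) * sqrt (real (b \<theta>)) - of_int h\<bar> < \<delta> / (2 * pi)"
        using m \<theta> by blast
      have "t * sqrt ((of_int (k \<theta>))\<^sup>2 + 4) / 2 - 2 * pi * of_int h
          = 2 * pi * ((of_int m + \<beta>) * sqrt (real (b \<theta>)) - of_int h)"
        by (simp add: t_def b algebra_simps)
      then have "\<bar>t * sqrt ((of_int (k \<theta>))\<^sup>2 + 4) / 2 - 2 * pi * of_int h\<bar>
          = 2 * pi * \<bar>(of_int m + \<beta>) * sqrt (real (b \<theta>)) - of_int h\<bar>"
        by (simp add: abs_mult)
      also have "\<dots> \<le> \<delta>"
        using h by (simp add: field_simps)
      finally show ?thesis
        unfolding phase[OF \<theta>, symmetric] by (rule B[OF \<theta>])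
    qed
    let ?U = "transition_matrix (corona G K1) t"
    have "\<gamma> *s axis (v, None) 1 = corona_vec (\<gamma> *s axis v 1) 0"
      by (simp add: corona_vec_axis[symmetric] corona_vec_smult)
    also have "\<dots> = (\<Sum>\<theta>\<in>S. exp (- (\<i> * complex_of_real (pi / g)) * \<theta>) *s corona_vec (x \<theta>) 0)"
      unfolding \<gamma>(2)[symmetric] by (simp add: corona_vec_sum corona_vec_smult)
    finally have "?U *v axis (u, None) 1 - \<gamma> *s axis (v, None) 1
        = (\<Sum>\<theta>\<in>S. ?U *v corona_vec (x \<theta>) 0
          - exp (- (\<i> * complex_of_real (pi / g)) * \<theta>) *s corona_vec (x \<theta>) 0)"
      unfolding corona_vec_axis[symmetric] u
      by (simp only: corona_vec_sum matrix_vector_mult_sum sum_subtractf)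
    then have "norm (?U *v axis (u, None) 1 - \<gamma> *s axis (v, None) 1) \<le> (\<Sum>\<theta>\<in>S. \<delta> * B \<theta>)"
      by (simp only:) (rule sum_norm_le[OF err])
    also have "\<dots> = \<delta> * (T - 1)"
      by (simp add: T_def sum_distrib_left)
    also have "\<dots> < \<delta> * T"
      using \<delta> by simp
    also have "\<dots> = \<epsilon>"
      using T by (simp add: \<delta>_def)
    finally show "\<exists>\<tau> \<gamma>. norm \<gamma> = 1 \<and>
        norm (transition_matrix (corona G K1) \<tau> *v axis (u, None) 1 - \<gamma> *s axis (v, None) 1) < \<epsilon>"
      using \<gamma>(1) by blast
  qed
qed

end
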